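(* Suppose that the graph assumption, the two Bregman divergence assumptions (Lipschitz in the first argument, convex in the second argument), the convexity/compactness assumption, the Lipschitz-gradient assumption and the strong monotonicity assumption stated in the context all hold. Let $0<a_1<\frac12$ and $\frac23<a_2<1$. For each horizon $T$, run the algorithm of the context with stepsizes, for $t\ge 1$, $$\alpha_t=\frac{1}{t^{a_1}},\qquad \beta_t=\frac{1}{(T+1)^{a_2}},\qquad \gamma_t=\frac{1}{(T+1)^{1-a_2}} .$$ Then, for each $i\in[N]$, the generated sequences $\{x_{i,1},\dots,x_{i,T}\}$ satisfy $$Reg_i(T)=\mathcal O\Big(T^{\max\{\frac12+a_1,\ \frac12+\frac{a_2}{2},\ 1-\frac{a_1}{2}\}}\Big)+\mathcal O\Big(T^{\frac12+a_1}\sqrt{\Phi_T^*}\Big),$$ $$R_g(T)=\mathcal O\Big(T^{\max\{1-\frac{a_1}{2},\ 2-\frac32 a_2\}}\Big)+\mathcal O\Big(T^{\max\{\frac12+\frac{a_1}{2},\ \frac32+a_1-\frac{3a_2}{2}\}}\sqrt{\Phi_T^*}\Big).$$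
   Context: Notation. $[N]=\{1,\dots,N\}$; $col(y_1,\dots,y_k)$ is the stacked column vector; $[v]_+$ is the projection of $v\in\mathbb R^m$ onto $\mathbb R^m_+$; $\|\cdot\|$ is the Euclidean norm (spectral norm for matrices); vector inequalities are entrywise. $h_1=\mathcal O(h_2)$ means $|h_1|\le C h_2$ for a constant $C>0$ (here independent of $T$). Game. There are $N$ players; player $i$ has an action set $\Omega_i\subseteq\mathbb R^{n_i}$, and $n=\sum_i n_i$. At time $t$, player $i$ has cost $J_{i,t}(x_i,x_{-i})$, where $x=col(x_1,\dots,x_N)$ and $x_{-i}$ denotes the actions of all players other than $i$, and the shared constraint is $g_t(x):=\sum_{i=1}^N g_{i,t}(x_i)\le \mathbf 0_m$ with $g_{i,t}=col(g_{i1,t},\dots,g_{im,t}):\mathbb R^{n_i}\to\mathbb R^m$. Put $\Omega_t=\{x\in\Omega_1\times\cdots\times\Omega_N: g_t(x)\le\mathbf 0_m\}$, $\nabla_iJ_{i,t}=\partial J_{i,t}/\partial x_i$, $\nabla g_{i,t}(x_i)\in\mathbb R^{m\times n_i}$ the Jacobian, and $F_t(x)=col(\nabla_1J_{1,t}(x),\dots,\nabla_NJ_{N,t}(x))$. Graph assumption. The players communicate over an undirected connected graph with vertex set $[N]$ and weighted adjacency matrix $A=(a_{ij})$, where, for $i\ne j$, $a_{ij}>0$ if $(j,i)$ is an edge and $a_{ij}=0$ otherwise; $a_{ii}>0$ for all $i$; $A^\top=A$ and $A\mathbf 1_N=\mathbf 1_N$. Bregman divergence. For each $i$, $\phi_i:\Omega_i\to\mathbb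 R$ is differentiable and $\mu_i$-strongly convex with $\mu_i>0$, $\mu_0=\min_i\mu_i$, and $D_{\phi_i}(\xi,\zeta)=\phi_i(\xi)-\phi_i(\zeta)-\langle\nabla\phi_i(\zeta),\xi-\zeta\rangle$. Bregman divergence assumptions: (Lipschitz) there is $K>0$ with $|D_{\phi_i}(\xi_1,\zeta)-D_{\phi_i}(\xi_2,\zeta)|\le K\|\xi_1-\xi_2\|$ for all $i$ and $\xi_1,\xi_2,\zeta\in\Omega_i$; (convexity) for all $i$ and $\xi\in\Omega_i$, $D_{\phi_i}(\xi,\cdot)$ is convex on $\Omega_i$. Convexity/compactness assumption. Each $\Omega_i$ is non-empty, compact and convex; $J_{i,t}(\cdot,x_{-i}):\Omega_i\to\mathbb R$ is differentiable and convex for every $x_{-i}\in\mathbb R^{n-n_i}$; each $g_{ij,t}$ is differentiable and convex on $\mathbb R^{n_i}$; $\Omega_t$ is non-empty and satisfies Slater's constraint qualification. Constants $L,M>0$ are fixed such that, for all $i,t$, $x_i\in\Omega_i$, $x_{-i}\in\mathbb R^{n-n_i}$: $\|x_i\|\le L$, $|J_{i,t}(x)|\le L$, $\|g_{i,t}(x_i)\|\le L$, $\|\nabla_iJ_{i,t}(x)\|\le M$, $\|\nabla g_{i,t}(x_i)\|\le M$. Lipschitz-gradient assumption. There is $H>0$ with $\|\nabla_iJ_{i,t}(x_i,x_{-i})-\nabla_iJ_{i,t}(y_i,y_{-i})\|\le H\|x-y\|$ for all $i,t$, $x_i,y_i\in\Omega_i$, $x_{-i},y_{-i}\in\mathbb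 R^{n-n_i}$. Strong monotonicity assumption. There is $\mu>0$ with $(F_t(x)-F_t(y))^\top(x-y)\ge\mu\|x-y\|^2$ for all $t$ and $x,y\in\Omega_1\times\cdots\times\Omega_N$. Variational GNE. $x_t^*\in\Omega_t$ denotes the unique solution of $F_t(x_t^* )^\top(x-x_t^* )\ge0$ for all $x\in\Omega_t$. With the augmented Lagrangian $\mathcal L_{i,t}=J_{i,t}(x)+\gamma_t\lambda^\top g_t(x)-\frac{\beta_t}{2}\|\lambda\|^2$, let $\lambda_t^*\in\mathbb R^m_+$ be an optimal dual variable (multiplier of the shared constraint, entering with weight $\gamma_t$, i.e. $\langle x_{i,t}^*-x,\nabla_iJ_{i,t}(x_t^* )+\gamma_t(\nabla g_{i,t}(x_{i,t}^* ))^\top\lambda_t^*\rangle\le0$ for all $x\in\Omega_i$, $i\in[N]$); it is bounded: $\|\lambda_t^*\|\le\Lambda$ for a constant $\Lambda>0$. Performance measures. $Reg_i(T)=\sum_{t=1}^T\big(J_{i,t}(x_{i,t},x_{-i,t}^* )-J_{i,t}(x_{i,t}^*,x_{-i,t}^* )\big)$, $R_g(T)=\big\|\big[\sum_{t=1}^Tg_t(x_t)\big]_+\big\|$, $\Phi_T^*=\sum_{t=1}^T\|x_{t+1}^*-x_t^*\|$, where $x_t=col(x_{1,t},\dots,x_{N,t})$. Algorithm. $\alpha_0=\beta_0=\gamma_0=1$. Player $i$ keeps $x_{ih,t}\in\mathbb R^{n_h}$ ($h\in[N]$, with $x_{ii,t}=x_{i,t}$) and $\lambda_{i,t}\in\mathbb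 R^m$. Initialization: $x_{i,1}\in\Omega_i$ arbitrary, $x_{ih,1}=\mathbf 0_{n_h}$ for $h\ne i$, $\lambda_{i,1}=\mathbf 0_m$. For $t\ge1$, with $\mathbf x_{i,t}=col(x_{i1,t},\dots,x_{iN,t})$ and $\tilde\lambda_{i,t}=\sum_{j=1}^Na_{ij}\lambda_{j,t}$: $x_{ih,t+1}=\sum_{k=1}^Na_{ik}x_{kh,t}$ for $h\ne i$; $\tilde x_{i,t+1}=\arg\min_{x\in\Omega_i}\{\alpha_t\langle x,\nabla_iJ_{i,t}(\mathbf x_{i,t})+\gamma_t(\nabla g_{i,t}(x_{i,t}))^\top\tilde\lambda_{i,t}\rangle+D_{\phi_i}(x,x_{i,t})\}$; $x_{i,t+1}=(1-\alpha_t)x_{i,t}+\alpha_t\tilde x_{i,t+1}$; $\lambda_{i,t+1}=[\tilde\lambda_{i,t}+\gamma_t(\gamma_tb_{i,t+1}-\beta_t\tilde\lambda_{i,t})]_+$ with $b_{i,t+1}=\nabla g_{i,t}(x_{i,t})(\tilde x_{i,t+1}-x_{i,t})+g_{i,t}(x_{i,t})$. *)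

theory Defs
  imports "HOL-Analysis.Analysis"
begin

(*
  The players are the elements of a finite type 'p, the shared constraint has values in real^'m.
  The dimensions n_i may differ: with D i a set of coordinates of a common index type 'd and
  n_i = card (D i), the space R^(n_i) is the space of vectors real^'d that vanish outside D i.
  A joint action col(x_1, ..., x_N) is x :: real^'d^'p with blocks x $ i; norm and inner product
  of this nested vector type are the Euclidean ones of the stacked vector.
  Time indices are natural numbers t >= 1.
*)

definition act_space :: "('p \<Rightarrow> 'd set) \<Rightarrow> 'p \<Rightarrow> (real^'d) set" where
  "act_space D i = {v. \<forall>k. k \<notin> D i \<longrightarrow> v $ k = 0}"

definition joint_space :: "('p \<Rightarrow> 'd set) \<Rightarrow> (real^'d^'p) set" where
  "joint_space D = {x. \<forall>i. x $ i \<in> act_space D i}"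

(* (y, x_{-i}) *)
definition with_action :: "real^'d^'p \<Rightarrow> 'p \<Rightarrow> real^'d \<Rightarrow> real^'d^'p" where
  "with_action x i y = (\<chi> j. if j = i then y else x $ j)"

(*
  One-sided at the boundary of S: f need only be differentiable as a function on S.  If S has
  empty interior, G is one choice of gradient; only its pairings with directions inside S are
  then determined by f.
*)
definition is_gradient_on :: "'a::real_inner set \<Rightarrow> ('a \<Rightarrow> real) \<Rightarrow> ('a \<Rightarrow> 'a) \<Rightarrow> bool" where
  "is_gradient_on S f G \<longleftrightarrow> (\<forall>x\<in>S. (f has_derivative (\<lambda>h. G x \<bullet> h)) (at x within S))"

definition strongly_convex_on :: "'a::real_inner set \<Rightarrow> real \<Rightarrow> ('a \<Rightarrow> real) \<Rightarrow> bool" where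
  "strongly_convex_on S \<mu> f \<longleftrightarrow> convex S \<and>
     (\<forall>x\<in>S. \<forall>y\<in>S. \<forall>u. 0 \<le> u \<longrightarrow> u \<le> 1 \<longrightarrow>
        f (u *\<^sub>R x + (1 - u) *\<^sub>R y)
          \<le> u * f x + (1 - u) * f y - \<mu> / 2 * u * (1 - u) * (norm (x - y))\<^sup>2)"


section \<open>Game\<close>

definition shared_constraint ::
    "('p::finite \<Rightarrow> nat \<Rightarrow> real^'d \<Rightarrow> real^'m) \<Rightarrow> nat \<Rightarrow> real^'d^'p \<Rightarrow> real^'m" where
  "shared_constraint g t x = (\<Sum>i\<in>UNIV. g i t (x $ i))"

definition feasible_set ::
    "('p::finite \<Rightarrow> (real^'d) set) \<Rightarrow> ('p \<Rightarrow> nat \<Rightarrow> real^'d \<Rightarrow> real^'m) \<Rightarrow> nat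
      \<Rightarrow> (real^'d^'p) set" where
  "feasible_set \<Omega> g t = {x. (\<forall>i. x $ i \<in> \<Omega> i) \<and> shared_constraint g t x \<le> 0}"

definition pseudo_gradient ::
    "('p \<Rightarrow> nat \<Rightarrow> real^'d^'p \<Rightarrow> real^'d) \<Rightarrow> nat \<Rightarrow> real^'d^'p \<Rightarrow> real^'d^'p" where
  "pseudo_gradient dJ t x = (\<chi> i. dJ i t x)"

(* dJ i t x is the partial gradient of J i t in player i's action, dg i t y the Jacobian of g i t;
   the columns of the Jacobian that do not belong to R^(n_i) are zero. *)
definition game_derivatives ::
    "('p::finite \<Rightarrow> ('d::finite) set) \<Rightarrow> ('p \<Rightarrow> (real^'d) set)
      \<Rightarrow> ('p \<Rightarrow> nat \<Rightarrow> real^'d^'p \<Rightarrow> real) \<Rightarrow> ('p \<Rightarrow> nat \<Rightarrow> real^'d^'p \<Rightarrow> real^'d)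
      \<Rightarrow> ('p \<Rightarrow> nat \<Rightarrow> real^'d \<Rightarrow> real^'m::finite) \<Rightarrow> ('p \<Rightarrow> nat \<Rightarrow> real^'d \<Rightarrow> real^'d^'m) \<Rightarrow> bool" where
  "game_derivatives D \<Omega> J dJ g dg \<longleftrightarrow>
     (\<forall>i. \<forall>t\<ge>1.
        (\<forall>x\<in>joint_space D.
           is_gradient_on (\<Omega> i) (\<lambda>y. J i t (with_action x i y)) (\<lambda>y. dJ i t (with_action x i y))) \<and>
        (\<forall>x\<in>joint_space D. x $ i \<in> \<Omega> i \<longrightarrow> dJ i t x \<in> act_space D i) \<and>
        (\<forall>y\<in>act_space D i.
           (g i t has_derivative ((*v) (dg i t y))) (at y within act_space D i) \<and>
           (\<forall>j. dg i t y $ j \<in> act_space D i)))"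

definition convexity_compactness ::
    "('p::finite \<Rightarrow> ('d::finite) set) \<Rightarrow> ('p \<Rightarrow> (real^'d) set)
      \<Rightarrow> ('p \<Rightarrow> nat \<Rightarrow> real^'d^'p \<Rightarrow> real) \<Rightarrow> ('p \<Rightarrow> nat \<Rightarrow> real^'d \<Rightarrow> real^'m::finite) \<Rightarrow> bool" where
  "convexity_compactness D \<Omega> J g \<longleftrightarrow>
     (\<forall>i. \<Omega> i \<subseteq> act_space D i \<and> \<Omega> i \<noteq> {} \<and> compact (\<Omega> i) \<and> convex (\<Omega> i)) \<and>
     (\<forall>i. \<forall>t\<ge>1. \<forall>x\<in>joint_space D. convex_on (\<Omega> i) (\<lambda>y. J i t (with_action x i y))) \<and>
     (\<forall>i. \<forall>t\<ge>1. \<forall>j. convex_on (act_space D i) (\<lambda>y. g i t y $ j)) \<and>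
     (\<forall>t\<ge>1. feasible_set \<Omega> g t \<noteq> {}) \<and>
     (\<forall>t\<ge>1. \<exists>x. (\<forall>i. x $ i \<in> \<Omega> i) \<and> (\<forall>j. shared_constraint g t x $ j < 0))"

definition game_bounds ::
    "('p::finite \<Rightarrow> ('d::finite) set) \<Rightarrow> ('p \<Rightarrow> (real^'d) set)
      \<Rightarrow> ('p \<Rightarrow> nat \<Rightarrow> real^'d^'p \<Rightarrow> real) \<Rightarrow> ('p \<Rightarrow> nat \<Rightarrow> real^'d^'p \<Rightarrow> real^'d)
      \<Rightarrow> ('p \<Rightarrow> nat \<Rightarrow> real^'d \<Rightarrow> real^'m::finite) \<Rightarrow> ('p \<Rightarrow> nat \<Rightarrow> real^'d \<Rightarrow> real^'d^'m)
      \<Rightarrow> real \<Rightarrow> real \<Rightarrow> bool" where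
  "game_bounds D \<Omega> J dJ g dg L M \<longleftrightarrow>
     (\<forall>i. \<forall>y\<in>\<Omega> i. norm y \<le> L) \<and>
     (\<forall>i. \<forall>t\<ge>1. \<forall>x\<in>joint_space D. x $ i \<in> \<Omega> i \<longrightarrow> \<bar>J i t x\<bar> \<le> L \<and> norm (dJ i t x) \<le> M) \<and>
     (\<forall>i. \<forall>t\<ge>1. \<forall>y\<in>\<Omega> i. norm (g i t y) \<le> L \<and> onorm ((*v) (dg i t y)) \<le> M)"

definition lipschitz_gradients ::
    "('p::finite \<Rightarrow> ('d::finite) set) \<Rightarrow> ('p \<Rightarrow> (real^'d) set)
      \<Rightarrow> ('p \<Rightarrow> nat \<Rightarrow> real^'d^'p \<Rightarrow> real^'d) \<Rightarrow> real \<Rightarrow> bool" where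
  "lipschitz_gradients D \<Omega> dJ H \<longleftrightarrow>
     (\<forall>i. \<forall>t\<ge>1. \<forall>x\<in>joint_space D. \<forall>y\<in>joint_space D.
        x $ i \<in> \<Omega> i \<longrightarrow> y $ i \<in> \<Omega> i \<longrightarrow> norm (dJ i t x - dJ i t y) \<le> H * norm (x - y))"

definition strongly_monotone ::
    "('p::finite \<Rightarrow> (real^'d::finite) set) \<Rightarrow> ('p \<Rightarrow> nat \<Rightarrow> real^'d^'p \<Rightarrow> real^'d) \<Rightarrow> real \<Rightarrow> bool" where
  "strongly_monotone \<Omega> dJ \<mu> \<longleftrightarrow>
     (\<forall>t\<ge>1. \<forall>x y. (\<forall>i. x $ i \<in> \<Omega> i) \<longrightarrow> (\<forall>i. y $ i \<in> \<Omega> i) \<longrightarrow>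
        (pseudo_gradient dJ t x - pseudo_gradient dJ t y) \<bullet> (x - y) \<ge> \<mu> * (norm (x - y))\<^sup>2)"

definition variational_GNE ::
    "('p::finite \<Rightarrow> (real^'d::finite) set) \<Rightarrow> ('p \<Rightarrow> nat \<Rightarrow> real^'d^'p \<Rightarrow> real^'d)
      \<Rightarrow> ('p \<Rightarrow> nat \<Rightarrow> real^'d \<Rightarrow> real^'m::finite) \<Rightarrow> nat \<Rightarrow> real^'d^'p \<Rightarrow> bool" where
  "variational_GNE \<Omega> dJ g t xs \<longleftrightarrow>
     xs \<in> feasible_set \<Omega> g t \<and>
     (\<forall>x\<in>feasible_set \<Omega> g t. pseudo_gradient dJ t xs \<bullet> (x - xs) \<ge> 0)"

(* lam is a multiplier of the shared constraint that enters with weight gam *)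
definition weighted_multiplier ::
    "('p::finite \<Rightarrow> (real^'d::finite) set) \<Rightarrow> ('p \<Rightarrow> nat \<Rightarrow> real^'d^'p \<Rightarrow> real^'d)
      \<Rightarrow> ('p \<Rightarrow> nat \<Rightarrow> real^'d \<Rightarrow> real^'d^'m::finite) \<Rightarrow> nat \<Rightarrow> real^'d^'p \<Rightarrow> real \<Rightarrow> real^'m \<Rightarrow> bool" where
  "weighted_multiplier \<Omega> dJ dg t xs gam lam \<longleftrightarrow>
     0 \<le> lam \<and>
     (\<forall>i. \<forall>y\<in>\<Omega> i.
        (xs $ i - y) \<bullet> (dJ i t xs + gam *\<^sub>R (transpose (dg i t (xs $ i)) *v lam)) \<le> 0)"


section \<open>Communication graph\<close>

(* E is the edge set of the graph; (1::real^'p) is the all-ones vector *)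
definition graph_assumption :: "('p::finite \<times> 'p) set \<Rightarrow> real^'p^'p \<Rightarrow> bool" where
  "graph_assumption E A \<longleftrightarrow>
     sym E \<and> (\<forall>i j. (i, j) \<in> E\<^sup>*) \<and>
     (\<forall>i j. i \<noteq> j \<longrightarrow> (if (j, i) \<in> E then A $ i $ j > 0 else A $ i $ j = 0)) \<and>
     (\<forall>i. A $ i $ i > 0) \<and>
     transpose A = A \<and> A *v 1 = 1"


section \<open>Bregman divergence\<close>

definition bregman :: "('a::real_inner \<Rightarrow> real) \<Rightarrow> ('a \<Rightarrow> 'a) \<Rightarrow> 'a \<Rightarrow> 'a \<Rightarrow> real" where
  "bregman f df \<xi> \<zeta> = f \<xi> - f \<zeta> - df \<zeta> \<bullet> (\<xi> - \<zeta>)"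

definition bregman_generators ::
    "('p \<Rightarrow> 'a::real_inner set) \<Rightarrow> ('p \<Rightarrow> 'a \<Rightarrow> real) \<Rightarrow> ('p \<Rightarrow> 'a \<Rightarrow> 'a) \<Rightarrow> ('p \<Rightarrow> real) \<Rightarrow> bool" where
  "bregman_generators \<Omega> \<phi> d\<phi> \<mu> \<longleftrightarrow>
     (\<forall>i. is_gradient_on (\<Omega> i) (\<phi> i) (d\<phi> i) \<and> \<mu> i > 0 \<and> strongly_convex_on (\<Omega> i) (\<mu> i) (\<phi> i))"

definition bregman_lipschitz ::
    "('p \<Rightarrow> 'a::real_inner set) \<Rightarrow> ('p \<Rightarrow> 'a \<Rightarrow> real) \<Rightarrow> ('p \<Rightarrow> 'a \<Rightarrow> 'a) \<Rightarrow> real \<Rightarrow> bool" where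
  "bregman_lipschitz \<Omega> \<phi> d\<phi> K \<longleftrightarrow>
     (\<forall>i. \<forall>\<xi>1\<in>\<Omega> i. \<forall>\<xi>2\<in>\<Omega> i. \<forall>\<zeta>\<in>\<Omega> i.
        \<bar>bregman (\<phi> i) (d\<phi> i) \<xi>1 \<zeta> - bregman (\<phi> i) (d\<phi> i) \<xi>2 \<zeta>\<bar> \<le> K * norm (\<xi>1 - \<xi>2))"

definition bregman_convex ::
    "('p \<Rightarrow> 'a::real_inner set) \<Rightarrow> ('p \<Rightarrow> 'a \<Rightarrow> real) \<Rightarrow> ('p \<Rightarrow> 'a \<Rightarrow> 'a) \<Rightarrow> bool" where
  "bregman_convex \<Omega> \<phi> d\<phi> \<longleftrightarrow>
     (\<forall>i. \<forall>\<xi>\<in>\<Omega> i. convex_on (\<Omega> i) (\<lambda>\<zeta>. bregman (\<phi> i) (d\<phi> i) \<xi> \<zeta>))"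


section \<open>Algorithm\<close>

definition alpha_step :: "real \<Rightarrow> nat \<Rightarrow> real" where
  "alpha_step a1 t = (if t = 0 then 1 else 1 / real t powr a1)"

definition beta_step :: "real \<Rightarrow> nat \<Rightarrow> nat \<Rightarrow> real" where
  "beta_step a2 T t = (if t = 0 then 1 else 1 / (real T + 1) powr a2)"

definition gamma_step :: "real \<Rightarrow> nat \<Rightarrow> nat \<Rightarrow> real" where
  "gamma_step a2 T t = (if t = 0 then 1 else 1 / (real T + 1) powr (1 - a2))"

(* projection onto the nonnegative orthant *)
definition proj_nonneg :: "real^'m \<Rightarrow> real^'m::finite" where
  "proj_nonneg v = closest_point {w. 0 \<le> w} v"

definition mixed_dual :: "real^'p^'p \<Rightarrow> ('p::finite \<Rightarrow> real^'m) \<Rightarrow> 'p \<Rightarrow> real^'m" where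
  "mixed_dual A lam i = (\<Sum>j\<in>UNIV. A $ i $ j *\<^sub>R lam j)"

(*
  X t i $ h is player i's estimate x_{ih,t}, in particular X t i $ i is its own action; Xt t i is
  the minimiser computed for time t (so Xt is used from time 2 on); lam t i is the dual variable.
*)
definition algorithm_run ::
    "('p::finite \<Rightarrow> (real^'d::finite) set) \<Rightarrow> ('p \<Rightarrow> nat \<Rightarrow> real^'d^'p \<Rightarrow> real^'d)
      \<Rightarrow> ('p \<Rightarrow> nat \<Rightarrow> real^'d \<Rightarrow> real^'m::finite) \<Rightarrow> ('p \<Rightarrow> nat \<Rightarrow> real^'d \<Rightarrow> real^'d^'m)
      \<Rightarrow> real^'p^'p \<Rightarrow> ('p \<Rightarrow> real^'d \<Rightarrow> real) \<Rightarrow> ('p \<Rightarrow> real^'d \<Rightarrow> real^'d)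
      \<Rightarrow> (nat \<Rightarrow> real) \<Rightarrow> (nat \<Rightarrow> real) \<Rightarrow> (nat \<Rightarrow> real)
      \<Rightarrow> (nat \<Rightarrow> 'p \<Rightarrow> real^'d^'p) \<Rightarrow> (nat \<Rightarrow> 'p \<Rightarrow> real^'d) \<Rightarrow> (nat \<Rightarrow> 'p \<Rightarrow> real^'m) \<Rightarrow> bool" where
  "algorithm_run \<Omega> dJ g dg A \<phi> d\<phi> \<alpha> \<beta> \<gamma> X Xt lam \<longleftrightarrow>
     (\<forall>i. X 1 i $ i \<in> \<Omega> i \<and> (\<forall>h. h \<noteq> i \<longrightarrow> X 1 i $ h = 0) \<and> lam 1 i = 0) \<and>
     (\<forall>t\<ge>1. \<forall>i.
        (\<forall>h. h \<noteq> i \<longrightarrow> X (t + 1) i $ h = (\<Sum>k\<in>UNIV. A $ i $ k *\<^sub>R X t k $ h)) \<and>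
        is_arg_min
          (\<lambda>x. \<alpha> t * (x \<bullet> (dJ i t (X t i)
                 + \<gamma> t *\<^sub>R (transpose (dg i t (X t i $ i)) *v mixed_dual A (lam t) i)))
               + bregman (\<phi> i) (d\<phi> i) x (X t i $ i))
          (\<lambda>x. x \<in> \<Omega> i) (Xt (t + 1) i) \<and>
        X (t + 1) i $ i = (1 - \<alpha> t) *\<^sub>R (X t i $ i) + \<alpha> t *\<^sub>R Xt (t + 1) i \<and>
        (let b = dg i t (X t i $ i) *v (Xt (t + 1) i - X t i $ i) + g i t (X t i $ i);
             lt = mixed_dual A (lam t) i
         in lam (t + 1) i = proj_nonneg (lt + \<gamma> t *\<^sub>R (\<gamma> t *\<^sub>R b - \<beta> t *\<^sub>R lt))))"

(* col(x_{1,t}, ..., x_{N,t}) *)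
definition actions :: "(nat \<Rightarrow> 'p \<Rightarrow> real^'d^'p) \<Rightarrow> nat \<Rightarrow> real^'d^'p" where
  "actions X t = (\<chi> i. X t i $ i)"


section \<open>Performance measures\<close>

definition regret ::
    "('p \<Rightarrow> nat \<Rightarrow> real^'d^'p \<Rightarrow> real) \<Rightarrow> (nat \<Rightarrow> real^'d^'p) \<Rightarrow> (nat \<Rightarrow> real^'d^'p)
      \<Rightarrow> 'p \<Rightarrow> nat \<Rightarrow> real" where
  "regret J xs x i T = (\<Sum>t=1..T. J i t (with_action (xs t) i (x t $ i)) - J i t (xs t))"

definition constraint_violation ::
    "('p::finite \<Rightarrow> nat \<Rightarrow> real^'d \<Rightarrow> real^'m::finite) \<Rightarrow> (nat \<Rightarrow> real^'d^'p) \<Rightarrow> nat \<Rightarrow> real" where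
  "constraint_violation g x T = norm (proj_nonneg (\<Sum>t=1..T. shared_constraint g t (x t)))"

definition path_length :: "(nat \<Rightarrow> 'a::real_normed_vector) \<Rightarrow> nat \<Rightarrow> real" where
  "path_length xs T = (\<Sum>t=1..T. norm (xs (t + 1) - xs t))"

end

theory Submission
  imports Defs
begin

text \<open>
  The proof is an energy argument with a free dual comparator.  For every l \<ge> 0, master_inequality
  bounds \<mu> times the total squared distance of the actions to the equilibria plus \<gamma> l \<bullet> S, S the
  summed constraint value, by an expression

    P + Q |l|^2,   P of order T^(2 a1) (1 + \<Phi>) + T^(1 - a1) + T^a2,
                   Q of order T^(1 - a2) + \<gamma>^2 T^(1 - a1).

  Taking l = 0, the squared distances are at most of order P, and Cauchy-Schwarz in time bounds the
  regret by the square root of T P.  Taking l to be the best multiple of the projection of S onto the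
  nonnegative orthant, the violation is at most of order sqrt (P Q) / \<gamma>.  Inserting the powers of T
  gives the exponents of the theorem.

  The energy consists of the Bregman divergences of the actions from the equilibrium, weighted with
  1/\<alpha>^2, and the squared distances of the multipliers from l, weighted with 1/(2 \<gamma>).
  A primal step decreases the first part (mirror_step_inequality) and a dual step the second one
  (dual_step); the inner products of a player's multiplier with the linearised constraint cancel
  when the two are added (player_step).  What remains is the following.  The equilibria
  move, which costs T^(2 a1) \<Phi> (sum_bregman_decrease).  Each move of the players is of relative size
  \<alpha>, and so is the error of their estimates of each other, which costs the sum of the step sizes,
  T^(1 - a1).  The actions are not feasible, so that the variational inequality at the equilibrium
  holds for them only up to the weighted multiplier, which costs \<gamma> T \<le> T^a2
  (variational_lower_bound).

  The estimates and the multipliers are local copies that are only averaged over the graph.  On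
  vectors with a vanishing component or a vanishing sum, averaging contracts by a fixed factor
  (averaging_contraction), so the disagreement is of the order of the increments: \<alpha> for the
  estimates, and \<gamma>^2 for the multipliers thanks to the regularisation \<beta>.
\<close>

section \<open>First-order inequalities on convex sets\<close>

text \<open>
  Action sets may have empty interior, so gradients are only known through difference
  quotients along segments inside the set. The upper bound has the form c + s k to serve, with one
  proof, convex functions and minima (k = 0) and strongly convex functions (k > 0); the term s k
  disappears in the limit.
\<close>
lemma directional_derivative_le:
  fixes f :: "'a::real_normed_vector \<Rightarrow> real"
  assumes "convex S" "x \<in> S" "y \<in> S" and deriv: "(f has_derivative f') (at x within S)"
    and upper: "\<And>s. 0 < s \<Longrightarrow> s \<le> 1 \<Longrightarrow> f (x + s *\<^sub>R (y - x)) \<le> f x + s * (c + s * k)"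
  shows "f' (y - x) \<le> c"
proof -
  define p where "p = (\<lambda>s::real. x + s *\<^sub>R (y - x))"
  have p_in: "p ` {0..1} \<subseteq> S"
  proof
    fix z assume "z \<in> p ` {0..1}"
    then obtain s where s: "0 \<le> s" "s \<le> 1" "z = p s" by auto
    have "p s = (1 - s) *\<^sub>R x + s *\<^sub>R y" by (simp add: p_def algebra_simps)
    then show "z \<in> S" using s assms(1-3) by (simp add: convexD)
  qed
  have p0: "p 0 = x" by (simp add: p_def)
  have "(p has_derivative (\<lambda>s. s *\<^sub>R (y - x))) (at 0 within {0..1})"
    unfolding p_def by (auto intro!: derivative_eq_intros)
  moreover have "(f has_derivative f') (at (p 0) within p ` {0..1})"
    using has_derivative_subset[OF deriv p_in] p0 by simp
  ultimately have "((\<lambda>s. f (p s)) has_derivative (\<lambda>s. f' (s *\<^sub>R (y - x)))) (at 0 within {0..1})"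
    by (rule has_derivative_in_compose)
  moreover have "f' (s *\<^sub>R (y - x)) = f' (y - x) * s" for s
    using linear_simps(5)[OF has_derivative_bounded_linear[OF deriv]] by simp
  ultimately have "((\<lambda>s. f (p s)) has_field_derivative f' (y - x)) (at 0 within {0..1})"
    by (simp add: has_field_derivative_def)
  then have lim: "((\<lambda>s. (f (p s) - f x) / s) \<longlongrightarrow> f' (y - x)) (at 0 within {0..1})"
    by (simp add: has_field_derivative_iff p0)
  have lim': "((\<lambda>s. c + s * k) \<longlongrightarrow> c + 0 * k) (at 0 within {0..1})"
    by (intro tendsto_intros)
  have ev: "\<forall>\<^sub>F s in at 0 within {0..1}. (f (p s) - f x) / s \<le> c + s * k"
  proof -
    have "(f (p s) - f x) / s \<le> c + s * k" if "s \<in> {0..1}" "s \<noteq> 0" for s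
    proof -
      have "0 < s" "s \<le> 1" using that by auto
      then show ?thesis using upper[of s] by (simp add: p_def field_simps)
    qed
    then show ?thesis by (auto simp: eventually_at_filter)
  qed
  have "at (0::real) within {0..1} \<noteq> bot"
    by (simp add: trivial_limit_within islimpt_Icc)
  from tendsto_le[OF this lim' lim ev] show ?thesis by simp
qed

lemma convex_gradient_le:
  fixes f :: "'a::real_normed_vector \<Rightarrow> real"
  assumes "convex_on S f" "x \<in> S" "y \<in> S" "(f has_derivative f') (at x within S)"
  shows "f x + f' (y - x) \<le> f y"
proof -
  have "f' (y - x) \<le> f y - f x"
  proof (rule directional_derivative_le[OF _ assms(2-4), where k = 0])
    show "convex S" using assms(1) by (simp add: convex_on_def)
    fix s :: real assume s: "0 < s" "s \<le> 1"
    have "x + s *\<^sub>R (y - x) = (1 - s) *\<^sub>R x + s *\<^sub>R y" by (simp add: algebra_simps)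
    then have "f (x + s *\<^sub>R (y - x)) \<le> (1 - s) * f x + s * f y"
      using convex_onD[OF assms(1), of s x y] s assms(2,3) by simp
    then show "f (x + s *\<^sub>R (y - x)) \<le> f x + s * (f y - f x + s * 0)"
      by (simp add: algebra_simps)
  qed
  then show ?thesis by simp
qed

lemma minimum_derivative_nonneg:
  fixes f :: "'a::real_normed_vector \<Rightarrow> real"
  assumes "convex S" "x \<in> S" "y \<in> S" "(f has_derivative f') (at x within S)"
    and "\<And>z. z \<in> S \<Longrightarrow> f x \<le> f z"
  shows "0 \<le> f' (y - x)"
proof -
  have "- f' (y - x) \<le> 0"
  proof (rule directional_derivative_le[OF assms(1-3) has_derivative_minus[OF assms(4)], where k = 0])
    fix s :: real assume s: "0 < s" "s \<le> 1"
    have "x + s *\<^sub>R (y - x) = (1 - s) *\<^sub>R x + s *\<^sub>R y" by (simp add: algebra_simps)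
    then have "x + s *\<^sub>R (y - x) \<in> S" using assms(1-3) s by (simp add: convexD)
    then show "- f (x + s *\<^sub>R (y - x)) \<le> - f x + s * (0 + s * 0)" using assms(5) by simp
  qed
  then show ?thesis by simp
qed

text \<open>
  The strong convexity inequality along the segment from \<zeta> to \<xi> has the quadratic term
  (1 - s) \<mu>/2 |\<xi> - \<zeta>|^2 per unit of s, whose limit at s = 0 is the full \<mu>/2
  |\<xi> - \<zeta>|^2.
\<close>
lemma bregman_ge_quadratic:
  assumes sc: "strongly_convex_on S \<mu> f" and grad: "is_gradient_on S f df"
    and in_S: "\<xi> \<in> S" "\<zeta> \<in> S"
  shows "\<mu> / 2 * (norm (\<xi> - \<zeta>))\<^sup>2 \<le> bregman f df \<xi> \<zeta>"
proof -
  define q where "q = \<mu> / 2 * (norm (\<xi> - \<zeta>))\<^sup>2"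
  have "df \<zeta> \<bullet> (\<xi> - \<zeta>) \<le> f \<xi> - f \<zeta> - q"
  proof (rule directional_derivative_le[where x = \<zeta> and y = \<xi> and S = S and f = f and k = q])
    show "convex S" using sc by (simp add: strongly_convex_on_def)
    show "(f has_derivative (\<bullet>) (df \<zeta>)) (at \<zeta> within S)"
      using grad in_S by (simp add: is_gradient_on_def)
    fix s :: real assume s: "0 < s" "s \<le> 1"
    have eq: "\<zeta> + s *\<^sub>R (\<xi> - \<zeta>) = s *\<^sub>R \<xi> + (1 - s) *\<^sub>R \<zeta>" by (simp add: algebra_simps)
    have "f (\<zeta> + s *\<^sub>R (\<xi> - \<zeta>))
        \<le> s * f \<xi> + (1 - s) * f \<zeta> - \<mu> / 2 * s * (1 - s) * (norm (\<xi> - \<zeta>))\<^sup>2"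
      unfolding eq using sc in_S s by (simp add: strongly_convex_on_def)
    also have "\<dots> = f \<zeta> + s * (f \<xi> - f \<zeta> - q + s * q)"
      by (simp add: q_def field_simps)
    finally show "f (\<zeta> + s *\<^sub>R (\<xi> - \<zeta>)) \<le> f \<zeta> + s * (f \<xi> - f \<zeta> - q + s * q)" .
  qed (use in_S in auto)
  then show ?thesis by (simp add: bregman_def q_def)
qed

lemma bregman_three_point:
  "df y \<bullet> (x - y) - df z \<bullet> (x - y) = bregman f df x z - bregman f df x y - bregman f df y z"
  by (simp add: bregman_def inner_diff_right)

text \<open>
  One damped mirror descent step, measured against a comparator w. Optimality of y and the
  three-point identity bound (y - w) \<bullet> G by the decrease of the divergence from z to the
  target y, divided by \<alpha>. The player only moves to z', a fraction \<alpha> of the way to y;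
  convexity of the divergence in its second argument turns the decrease towards y into the
  decrease towards z' at the price of a second factor 1/\<alpha>.
\<close>
lemma mirror_step_inequality:
  assumes conv: "convex S" and grad: "is_gradient_on S f df" and sc: "strongly_convex_on S \<mu> f"
    and bconv: "\<And>\<xi>. \<xi> \<in> S \<Longrightarrow> convex_on S (bregman f df \<xi>)"
    and \<alpha>: "0 < \<alpha>" "\<alpha> \<le> 1"
    and z: "z \<in> S" and w: "w \<in> S"
    and min: "is_arg_min (\<lambda>x. \<alpha> * (x \<bullet> G) + bregman f df x z) (\<lambda>x. x \<in> S) y"
    and z': "z' = (1 - \<alpha>) *\<^sub>R z + \<alpha> *\<^sub>R y"
  shows "(y - w) \<bullet> G + \<mu> / (2 * \<alpha>) * (norm (y - z))\<^sup>2
    \<le> (bregman f df w z - bregman f df w z') / \<alpha>\<^sup>2"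
proof -
  have y: "y \<in> S" and min': "\<And>x. x \<in> S \<Longrightarrow>
      \<alpha> * (y \<bullet> G) + bregman f df y z \<le> \<alpha> * (x \<bullet> G) + bregman f df x z"
    using min by (auto simp: is_arg_min_linorder)
  have "((\<lambda>x. \<alpha> * (x \<bullet> G) + bregman f df x z) has_derivative
      (\<lambda>h. \<alpha> * (h \<bullet> G) + (df y \<bullet> h - df z \<bullet> h))) (at y within S)"
    unfolding bregman_def
    using grad y unfolding is_gradient_on_def
    by (auto intro!: derivative_eq_intros)
  from minimum_derivative_nonneg[OF conv y w this min']
  have "0 \<le> \<alpha> * ((w - y) \<bullet> G) + (bregman f df w z - bregman f df w y - bregman f df y z)"
    by (simp add: bregman_three_point[symmetric])
  moreover have "(w - y) \<bullet> G = - ((y - w) \<bullet> G)" by (simp add: inner_diff_left)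
  ultimately have a: "\<alpha> * ((y - w) \<bullet> G) + bregman f df y z \<le> bregman f df w z - bregman f df w y"
    by simp
  \<comment> \<open>Convexity in the second argument: a fraction of the move realises that fraction of the decrease.\<close>
  have "bregman f df w z' \<le> (1 - \<alpha>) * bregman f df w z + \<alpha> * bregman f df w y"
    unfolding z' using convex_onD[OF bconv[OF w], of \<alpha> z y] \<alpha> z y by simp
  then have b: "\<alpha> * (bregman f df w z - bregman f df w y) \<le> bregman f df w z - bregman f df w z'"
    by (simp add: algebra_simps)
  have "\<alpha> * (\<alpha> * ((y - w) \<bullet> G) + \<mu> / 2 * (norm (y - z))\<^sup>2)
      \<le> \<alpha> * (bregman f df w z - bregman f df w y)"
    using a bregman_ge_quadratic[OF sc grad y z] \<alpha> by (intro mult_left_mono) auto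
  also note b
  finally have "(\<alpha> * (\<alpha> * ((y - w) \<bullet> G) + \<mu> / 2 * (norm (y - z))\<^sup>2)) / \<alpha>\<^sup>2
      \<le> (bregman f df w z - bregman f df w z') / \<alpha>\<^sup>2"
    by (rule divide_right_mono) simp
  moreover have "(\<alpha> * (\<alpha> * ((y - w) \<bullet> G) + \<mu> / 2 * (norm (y - z))\<^sup>2)) / \<alpha>\<^sup>2
      = (y - w) \<bullet> G + \<mu> / (2 * \<alpha>) * (norm (y - z))\<^sup>2"
    using \<alpha> by (simp add: field_simps power2_eq_square)
  ultimately show ?thesis by simp
qed

section \<open>Averaging over the communication graph\<close>

lemma graph_assumptionD:
  assumes "graph_assumption E A"
  shows "A $ i $ k \<ge> 0" "A $ i $ i > 0" "(\<Sum>k\<in>UNIV. A $ i $ k) = 1" "A $ i $ k = A $ k $ i"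
    "(k, i) \<in> E \<Longrightarrow> A $ i $ k > 0" "(i, k) \<in> E\<^sup>*"
proof -
  have off: "if (k, i) \<in> E then A $ i $ k > 0 else A $ i $ k = 0" if "i \<noteq> k"
    using assms that unfolding graph_assumption_def by blast
  show diag: "A $ i $ i > 0" and "(i, k) \<in> E\<^sup>*"
    using assms unfolding graph_assumption_def by blast+
  show "A $ i $ k \<ge> 0"
    using off diag by (cases "i = k") (auto split: if_splits)
  show "(k, i) \<in> E \<Longrightarrow> A $ i $ k > 0"
    using off diag by (cases "i = k") auto
  have "transpose A = A" and A1: "A *v 1 = 1" using assms by (auto simp: graph_assumption_def)
  then have "A $ k $ i = transpose A $ k $ i" by simp
  then show "A $ i $ k = A $ k $ i" by (simp add: transpose_def)
  have "(A *v 1) $ i = 1" by (simp add: A1)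
  then show "(\<Sum>k\<in>UNIV. A $ i $ k) = 1" by (simp add: matrix_vector_mult_def)
qed

lemma weighted_variance:
  fixes V :: "'p::finite \<Rightarrow> 'a::real_inner"
  assumes "(\<Sum>k\<in>UNIV. a k) = 1"
  defines "W \<equiv> \<Sum>k\<in>UNIV. a k *\<^sub>R V k"
  shows "(\<Sum>k\<in>UNIV. a k * (norm (V k - W))\<^sup>2) = (\<Sum>k\<in>UNIV. a k * (norm (V k))\<^sup>2) - (norm W)\<^sup>2"
proof -
  have "a k * (norm (V k - W))\<^sup>2 = a k * (norm (V k))\<^sup>2 - 2 * ((a k *\<^sub>R V k) \<bullet> W) + a k * (W \<bullet> W)" for k
    by (simp add: power2_norm_eq_inner inner_diff_left inner_diff_right inner_commute algebra_simps)
  then have "(\<Sum>k\<in>UNIV. a k * (norm (V k - W))\<^sup>2)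
      = (\<Sum>k\<in>UNIV. a k * (norm (V k))\<^sup>2) - 2 * (W \<bullet> W) + (\<Sum>k\<in>UNIV. a k) * (W \<bullet> W)"
    by (simp add: sum.distrib sum_subtractf W_def inner_sum_left sum_distrib_left[symmetric]
        sum_distrib_right[symmetric])
  then show ?thesis using assms(1) by (simp add: power2_norm_eq_inner)
qed

text \<open>
  Since the weights are doubly stochastic, averaging loses exactly the weighted variance around
  the local averages. This gives nonexpansiveness, and identifies the vectors that lose nothing.
\<close>
lemma averaging_energy_loss:
  fixes V :: "'p::finite \<Rightarrow> 'a::real_inner"
  assumes "graph_assumption E A"
  shows "(\<Sum>i\<in>UNIV. (norm (\<Sum>k\<in>UNIV. A $ i $ k *\<^sub>R V k))\<^sup>2)
    = (\<Sum>i\<in>UNIV. (norm (V i))\<^sup>2)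
      - (\<Sum>i\<in>UNIV. \<Sum>k\<in>UNIV. A $ i $ k * (norm (V k - (\<Sum>k\<in>UNIV. A $ i $ k *\<^sub>R V k)))\<^sup>2)"
proof -
  have "(\<Sum>i\<in>UNIV. \<Sum>k\<in>UNIV. A $ i $ k * (norm (V k))\<^sup>2)
      = (\<Sum>k\<in>UNIV. (\<Sum>i\<in>UNIV. A $ k $ i) * (norm (V k))\<^sup>2)"
    by (subst sum.swap) (simp add: sum_distrib_right graph_assumptionD(4)[OF assms])
  then have "(\<Sum>i\<in>UNIV. \<Sum>k\<in>UNIV. A $ i $ k * (norm (V k))\<^sup>2) = (\<Sum>i\<in>UNIV. (norm (V i))\<^sup>2)"
    by (simp add: graph_assumptionD(3)[OF assms])
  then show ?thesis
    by (simp add: weighted_variance[OF graph_assumptionD(3)[OF assms]] sum_subtractf)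
qed

lemma averaging_nonexpansive:
  fixes V :: "'p::finite \<Rightarrow> 'a::real_inner"
  assumes "graph_assumption E A"
  shows "(\<Sum>i\<in>UNIV. (norm (\<Sum>k\<in>UNIV. A $ i $ k *\<^sub>R V k))\<^sup>2) \<le> (\<Sum>i\<in>UNIV. (norm (V i))\<^sup>2)"
proof -
  have "0 \<le> (\<Sum>i\<in>UNIV. \<Sum>k\<in>UNIV.
      A $ i $ k * (norm (V k - (\<Sum>k\<in>UNIV. A $ i $ k *\<^sub>R V k)))\<^sup>2)"
    by (intro sum_nonneg mult_nonneg_nonneg graph_assumptionD(1)[OF assms]) simp
  then show ?thesis using averaging_energy_loss[OF assms, of V] by linarith
qed

lemma norm_vec_power2:
  fixes x :: "'a::real_inner^'n"
  shows "(norm x)\<^sup>2 = (\<Sum>i\<in>UNIV. (norm (x $ i))\<^sup>2)"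
  by (simp add: power2_norm_eq_inner inner_vec_def)

text \<open>
  If no energy is lost, each v k with positive weight in row i equals the local average at i. The
  diagonal weight is positive, so v i equals it too; hence v agrees along every edge, and the
  graph is connected.
\<close>
lemma averaging_strict:
  fixes v :: "real^'p::finite"
  assumes gr: "graph_assumption E A" and "norm v \<le> norm (A *v v)"
  shows "v $ i = v $ j"
proof -
  have Av: "(A *v v) $ i = (\<Sum>k\<in>UNIV. A $ i $ k *\<^sub>R v $ k)" for i
    by (simp add: matrix_vector_mult_def)
  let ?d = "\<lambda>i k. A $ i $ k * (norm (v $ k - (A *v v) $ i))\<^sup>2"
  have d0: "?d i k \<ge> 0" for i k using graph_assumptionD(1)[OF gr] by simp
  have "(norm v)\<^sup>2 \<le> (norm (A *v v))\<^sup>2" using assms(2) by simp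
  then have "(\<Sum>i\<in>UNIV. \<Sum>k\<in>UNIV. ?d i k) \<le> 0"
    using averaging_energy_loss[OF gr, of "\<lambda>k. v $ k"] by (simp add: norm_vec_power2 Av)
  moreover have "(\<Sum>i\<in>UNIV. \<Sum>k\<in>UNIV. ?d i k) \<ge> 0" by (intro sum_nonneg d0)
  ultimately have "(\<Sum>i\<in>UNIV. \<Sum>k\<in>UNIV. ?d i k) = 0" by linarith
  then have "?d i k = 0" for i k
    using d0 by (simp add: sum_nonneg_eq_0_iff sum_nonneg)
  then have eq: "v $ k = (A *v v) $ i" if "A $ i $ k > 0" for i k
    using that by (metis less_numeral_extra(3) mult_eq_0_iff norm_eq_zero power_eq_0_iff right_minus_eq)
  have edge: "v $ k = v $ i" if "(k, i) \<in> E" for i k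
    using eq[OF graph_assumptionD(5)[OF gr that]] eq[OF graph_assumptionD(2)[OF gr], of i] by simp
  have "(i, j) \<in> E\<^sup>*" by (rule graph_assumptionD(6)[OF gr])
  then show ?thesis by induction (use edge in auto)
qed

text \<open>
  Two consensus processes have to contract: players estimating the action of a player h, whose own
  error vanishes, and dual variables measured from their mean. Both live in a closed cone that
  contains no nonzero constant vector, and on its unit sphere the strict inequality
  averaging_strict becomes uniform by compactness.
\<close>
lemma averaging_contraction:
  fixes A :: "real^'p^'p::finite"
  assumes gr: "graph_assumption E A"
  obtains \<sigma> where "0 \<le> \<sigma>" "\<sigma> < 1"
    "\<And>v h. v $ h = 0 \<or> (\<Sum>i\<in>UNIV. v $ i) = 0 \<Longrightarrow> norm (A *v v) \<le> \<sigma> * norm v"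
proof -
  define Z where "Z = (\<Union>h. {v :: real^'p. v $ h = 0}) \<union> {v. (\<Sum>i\<in>UNIV. v $ i) = 0}"
  have "closed Z" unfolding Z_def
    by (intro closed_Un closed_UN ballI closed_Collect_eq finite continuous_intros)
  then have cpt: "compact (Z \<inter> sphere 0 1)" by (simp add: closed_Int_compact)
  have scale: "c *\<^sub>R v \<in> Z" if "v \<in> Z" for c v
    using that by (auto simp: Z_def sum_distrib_left[symmetric])
  have strict: "norm (A *v v) < 1" if "v \<in> Z" "norm v = 1" for v
  proof (rule ccontr)
    assume "\<not> norm (A *v v) < 1"
    then have const: "v $ i = v $ j" for i j using averaging_strict[OF gr, of v] that by simp
    from \<open>v \<in> Z\<close> have "v = 0"
    proof (unfold Z_def, elim UnE)
      assume "v \<in> (\<Union>h. {v. v $ h = 0})"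
      then obtain h where "v $ h = 0" by auto
      then show ?thesis using const by (metis vec_eq_iff zero_index)
    next
      assume s: "v \<in> {v. (\<Sum>i\<in>UNIV. v $ i) = 0}"
      have "v $ i = 0" for i
      proof -
        have "(\<Sum>j\<in>UNIV. v $ j) = (\<Sum>j\<in>(UNIV::'p set). v $ i)" by (rule sum.cong) (auto intro: const)
        then show ?thesis using s by simp
      qed
      then show ?thesis by (simp add: vec_eq_iff)
    qed
    then show False using that by simp
  qed
  obtain \<sigma> where \<sigma>: "0 \<le> \<sigma>" "\<sigma> < 1" "\<And>v. v \<in> Z \<inter> sphere 0 1 \<Longrightarrow> norm (A *v v) \<le> \<sigma>"
  proof (cases "Z \<inter> sphere 0 1 = {}")
    case True
    then show ?thesis using that[of 0] by auto
  next
    case False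
    have "continuous_on (Z \<inter> sphere 0 1) (\<lambda>v. norm (A *v v))"
      by (intro continuous_on_norm linear_continuous_on matrix_vector_mul_bounded_linear)
    from continuous_attains_sup[OF cpt False this] obtain w
      where "w \<in> Z \<inter> sphere 0 1" "\<forall>v\<in>Z \<inter> sphere 0 1. norm (A *v v) \<le> norm (A *v w)" by blast
    then show ?thesis using that[of "norm (A *v w)"] strict[of w] by auto
  qed
  show thesis
  proof (rule that[OF \<sigma>(1,2)])
    fix v :: "real^'p" and h
    assume "v $ h = 0 \<or> (\<Sum>i\<in>UNIV. v $ i) = 0"
    then have "v \<in> Z" by (auto simp: Z_def)
    show "norm (A *v v) \<le> \<sigma> * norm v"
    proof (cases "v = 0")
      case False
      have "norm (A *v (inverse (norm v) *\<^sub>R v)) \<le> \<sigma>"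
        using \<sigma>(3)[of "inverse (norm v) *\<^sub>R v"] scale[OF \<open>v \<in> Z\<close>] False by simp
      then show ?thesis
        using False by (simp add: matrix_vector_mult_scaleR field_simps)
    qed simp
  qed
qed

definition average :: "real^'p^'p \<Rightarrow> 'a::real_vector^'p \<Rightarrow> 'a^'p::finite" where
  "average A V = (\<chi> i. \<Sum>k\<in>UNIV. A $ i $ k *\<^sub>R V $ k)"

text \<open>
  The scalar contraction applies to each coordinate, because averaging acts on coordinates
  separately.
\<close>
lemma average_contraction:
  fixes V :: "real^'c::finite^'p::finite"
  assumes "0 \<le> \<sigma>"
    and scalar: "\<And>v h. v $ h = 0 \<or> (\<Sum>i\<in>UNIV. v $ i) = 0 \<Longrightarrow> norm (A *v v) \<le> \<sigma> * norm v"
    and V: "V $ h = 0 \<or> (\<Sum>i\<in>UNIV. V $ i) = 0"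
  shows "norm (average A V) \<le> \<sigma> * norm V"
proof -
  define slice where "slice c = (\<chi> i. V $ i $ c)" for c
  have sq: "(norm U)\<^sup>2 = (\<Sum>c\<in>UNIV. (norm (\<chi> i. U $ i $ c))\<^sup>2)" for U :: "real^'c^'p"
    by (simp add: norm_vec_power2) (rule sum.swap)
  have "(norm (average A V))\<^sup>2 = (\<Sum>c\<in>UNIV. (norm (A *v slice c))\<^sup>2)"
    unfolding sq by (simp add: average_def slice_def matrix_vector_mult_def)
  also have "\<dots> \<le> (\<Sum>c\<in>UNIV. (\<sigma> * norm (slice c))\<^sup>2)"
  proof (intro sum_mono power_mono norm_ge_zero scalar[where h = h])
    fix c
    have "(\<Sum>i\<in>UNIV. slice c $ i) = (\<Sum>i\<in>UNIV. V $ i) $ c" by (simp add: slice_def)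
    then show "slice c $ h = 0 \<or> (\<Sum>i\<in>UNIV. slice c $ i) = 0"
      using V by (auto simp: slice_def simp del: sum_component)
  qed
  also have "\<dots> = (\<sigma> * norm V)\<^sup>2"
    unfolding power_mult_distrib sq[of V] by (simp add: slice_def sum_distrib_left)
  finally show ?thesis using assms(1) by (simp add: power2_le_iff_abs_le)
qed

lemma sum_geometric_recursion:
  fixes u d :: "nat \<Rightarrow> real"
  assumes "0 \<le> \<sigma>" "\<sigma> < 1" and "\<And>t. u t \<ge> 0" and "\<And>t. d t \<ge> 0"
    and "\<And>t. t \<ge> 1 \<Longrightarrow> u (t + 1) \<le> \<sigma> * u t + d t"
  shows "(\<Sum>t=1..T. u t) \<le> (u 1 + (\<Sum>t=1..T. d t)) / (1 - \<sigma>)"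
proof -
  have "(\<Sum>t=1..T. u t) + u (T + 1) \<le> u 1 + \<sigma> * (\<Sum>t=1..T. u t) + (\<Sum>t=1..T. d t)"
  proof (induction T)
    case (Suc T)
    then show ?case using assms(5)[of "Suc T"] by (simp add: algebra_simps)
  qed simp
  with assms(3)[of "T + 1"] have "(1 - \<sigma>) * (\<Sum>t=1..T. u t) \<le> u 1 + (\<Sum>t=1..T. d t)"
    by (simp add: algebra_simps)
  then show ?thesis using assms(2) by (simp add: field_simps)
qed

section \<open>Projections, norms and summation by parts\<close>

text \<open>
  Summation by parts against increasing weights: the gaps d t come from the moving comparator, and
  a slack R - a (T + 1) has to be kept in the bound so that it can be multiplied by the larger
  weight of the next step.
\<close>
lemma weighted_telescope:
  fixes w a a' d :: "nat \<Rightarrow> real"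
  assumes w: "\<And>t. 0 \<le> w t" "\<And>t. w t \<le> w (Suc t)"
    and a: "\<And>t. t \<ge> 1 \<Longrightarrow> a t \<le> R" and d: "\<And>t. t \<ge> 1 \<Longrightarrow> a (Suc t) - a' t \<le> d t"
    and d0: "\<And>t. 0 \<le> d t"
  shows "(\<Sum>t=1..T. w t * (a t - a' t)) \<le> w T * (R - a (T + 1) + (\<Sum>t=1..T. d t))"
proof (induction T)
  case 0
  show ?case using w(1)[of 0] a[of 1] by simp
next
  case (Suc T)
  let ?S = "\<Sum>t=1..T. d t"
  have "w T * (R - a (T + 1) + ?S) \<le> w (Suc T) * (R - a (T + 1) + ?S)"
    using w(2)[of T] a[of "T + 1"] sum_nonneg[of "{1..T}" d] d0 by (intro mult_right_mono) auto
  moreover have "w (Suc T) * (a (Suc T) - a' (Suc T))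
      \<le> w (Suc T) * (a (Suc T) - a (Suc (Suc T)) + d (Suc T))"
    using w(1)[of "Suc T"] d[of "Suc T"] by (intro mult_left_mono) auto
  ultimately show ?case using Suc.IH by (simp add: algebra_simps)
qed

lemma orthant: "convex {w :: real^'m::finite. 0 \<le> w}" "closed {w :: real^'m. 0 \<le> w}"
    "{w :: real^'m. 0 \<le> w} \<noteq> {}"
proof -
  show "convex {w :: real^'m. 0 \<le> w}" by (auto simp: convex_def less_eq_vec_def)
  have "{w :: real^'m. 0 \<le> w} = {0..}" by auto
  then show "closed {w :: real^'m. 0 \<le> w}" by simp
  show "{w :: real^'m. 0 \<le> w} \<noteq> {}" by auto
qed

lemma proj_nonneg_nonneg: "0 \<le> proj_nonneg v"
  using closest_point_in_set[OF orthant(2,3), of v] by (simp add: proj_nonneg_def)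

lemma proj_nonneg_closer:
  fixes l v :: "real^'m::finite"
  assumes "0 \<le> l"
  shows "norm (proj_nonneg v - l) \<le> norm (v - l)"
  using closest_point_lipschitz[OF orthant, of v l] closest_point_self[of l "{w. 0 \<le> w}"] assms
  by (simp add: proj_nonneg_def dist_norm)

lemma norm_proj_nonneg_le_inner: "(norm (proj_nonneg v))\<^sup>2 \<le> proj_nonneg v \<bullet> v"
  using closest_point_dot[OF orthant(1,2), of 0 v]
  by (simp add: proj_nonneg_def power2_norm_eq_inner inner_diff_left inner_diff_right inner_commute)

lemma zero_in_act_space: "0 \<in> act_space D i"
  by (simp add: act_space_def)

lemma act_space_sum:
  "(\<And>k. k \<in> I \<Longrightarrow> v k \<in> act_space D i) \<Longrightarrow> (\<Sum>k\<in>I. c k *\<^sub>R v k) \<in> act_space D i"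
  by (auto simp: act_space_def intro!: sum.neutral)

lemma norm_matrix_le:
  fixes B :: "real^'d::finite^'m::finite"
  assumes "onorm ((*v) B) \<le> M"
  shows "norm (B *v h) \<le> M * norm h"
  by (rule order_trans[OF onorm[OF matrix_vector_mul_bounded_linear]])
    (simp add: mult_right_mono assms)

lemma inner_transpose: "h \<bullet> (transpose B *v l) = l \<bullet> (B *v h)"
  for B :: "real^'d::finite^'m::finite"
  by (metis dot_lmul_matrix inner_commute transpose_matrix_vector)

lemma norm_vec_le_sum: "norm x \<le> (\<Sum>i\<in>UNIV. norm (x $ i))" for x :: "'a::real_normed_vector^'n"
  by (simp add: norm_vec_def L2_set_le_sum)

lemma linear_minus_quadratic_le:
  fixes c q d :: real
  assumes "q > 0"
  shows "c * d - q * d\<^sup>2 \<le> c\<^sup>2 / (4 * q)"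
proof -
  have "0 \<le> (c - 2 * q * d)\<^sup>2 / (4 * q)" using assms by simp
  then show ?thesis using assms by (simp add: power2_eq_square field_simps)
qed

section \<open>Bounds for the game\<close>

text \<open>
  Besides the data of the game, the locale fixes three numbers that occur in the final constants:
  a contraction factor \<sigma> for averaging, a common modulus \<mu>0 of strong convexity, and
  the number N of players. N is a parameter rather than an expression in the type of players, so
  that constants built from it can be defined inside the locale. No horizon is fixed here:
  constants defined in this locale are therefore independent of it.
\<close>
locale tracking_game =
  fixes D :: "'p::finite \<Rightarrow> ('d::finite) set"
    and \<Omega> :: "'p \<Rightarrow> (real^'d) set"
    and J :: "'p \<Rightarrow> nat \<Rightarrow> real^'d^'p \<Rightarrow> real"
    and dJ :: "'p \<Rightarrow> nat \<Rightarrow> real^'d^'p \<Rightarrow> real^'d"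
    and g :: "'p \<Rightarrow> nat \<Rightarrow> real^'d \<Rightarrow> real^'m::finite"
    and dg :: "'p \<Rightarrow> nat \<Rightarrow> real^'d \<Rightarrow> real^'d^'m"
    and E :: "('p \<times> 'p) set"
    and A :: "real^'p^'p"
    and \<phi> :: "'p \<Rightarrow> real^'d \<Rightarrow> real"
    and d\<phi> :: "'p \<Rightarrow> real^'d \<Rightarrow> real^'d"
    and \<mu>\<phi> :: "'p \<Rightarrow> real"
    and xs :: "nat \<Rightarrow> real^'d^'p"
    and L M K H \<mu> \<Lambda> a1 a2 \<sigma> \<mu>0 N :: real
  assumes graph: "graph_assumption E A"
    and generators: "bregman_generators \<Omega> \<phi> d\<phi> \<mu>\<phi>"
    and K: "K > 0" and breg_lip: "bregman_lipschitz \<Omega> \<phi> d\<phi> K"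
    and breg_conv: "bregman_convex \<Omega> \<phi> d\<phi>"
    and conv_comp: "convexity_compactness D \<Omega> J g"
    and derivs: "game_derivatives D \<Omega> J dJ g dg"
    and L: "L > 0" and M: "M > 0" and bounds: "game_bounds D \<Omega> J dJ g dg L M"
    and H: "H > 0" and lip_grad: "lipschitz_gradients D \<Omega> dJ H"
    and \<mu>: "\<mu> > 0" and str_mono: "strongly_monotone \<Omega> dJ \<mu>"
    and a1: "0 < a1" "a1 < 1 / 2"
    and a2: "2 / 3 < a2" "a2 < 1"
    and vgne: "\<forall>t\<ge>1. variational_GNE \<Omega> dJ g t (xs t)"
    and \<Lambda>: "\<Lambda> > 0"
    and multipliers: "\<forall>T\<ge>1. \<forall>t\<in>{1..T}. \<exists>lam.
           weighted_multiplier \<Omega> dJ dg t (xs t) (gamma_step a2 T t) lam \<and> norm lam \<le> \<Lambda>"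
    and \<sigma>: "0 \<le> \<sigma>" "\<sigma> < 1"
    and contraction: "\<And>v h. v $ h = 0 \<or> (\<Sum>i\<in>UNIV. v $ i) = 0 \<Longrightarrow> norm (A *v v) \<le> \<sigma> * norm v"
    and \<mu>0: "0 < \<mu>0" "\<And>i. \<mu>0 \<le> \<mu>\<phi> i"
    and N: "N = real CARD('p)"
begin

abbreviation breg :: "'p \<Rightarrow> real^'d \<Rightarrow> real^'d \<Rightarrow> real" where
  "breg i \<equiv> bregman (\<phi> i) (d\<phi> i)"

text \<open>
  The bound on the linearised constraint value that drives the dual update.
\<close>
definition B :: real where "B = 2 * M * L + L"

lemma direction_bound_pos: "B > 0" using L M by (simp add: B_def add_pos_pos)

lemma N_ge_1: "1 \<le> N" by (simp add: N Suc_leI)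

lemma action_set:
  shows "convex (\<Omega> i)" and "y \<in> \<Omega> i \<Longrightarrow> y \<in> act_space D i" and "y \<in> \<Omega> i \<Longrightarrow> norm y \<le> L"
  using conv_comp bounds by (auto simp: convexity_compactness_def game_bounds_def)

lemma action_diff_bound: "y \<in> \<Omega> i \<Longrightarrow> z \<in> \<Omega> i \<Longrightarrow> norm (y - z) \<le> 2 * L"
  using norm_triangle_ineq4[of y z] action_set(3)[of y i] action_set(3)[of z i] by simp

lemma xs_feasible:
  assumes "t \<ge> 1"
  shows "xs t $ i \<in> \<Omega> i" "shared_constraint g t (xs t) \<le> 0" "xs t \<in> joint_space D"
proof -
  have "xs t \<in> feasible_set \<Omega> g t" using vgne assms by (auto simp: variational_GNE_def)
  then show "xs t $ i \<in> \<Omega> i" "shared_constraint g t (xs t) \<le> 0" "xs t \<in> joint_space D"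
    by (auto simp: feasible_set_def joint_space_def action_set(2))
qed

lemma cost_gradient_bound: "t \<ge> 1 \<Longrightarrow> x \<in> joint_space D \<Longrightarrow> x $ i \<in> \<Omega> i \<Longrightarrow> norm (dJ i t x) \<le> M"
  using bounds by (auto simp: game_bounds_def)

lemma constraint_bound: "t \<ge> 1 \<Longrightarrow> y \<in> \<Omega> i \<Longrightarrow> norm (g i t y) \<le> L"
  using bounds by (auto simp: game_bounds_def)

lemma jacobian_bound: "t \<ge> 1 \<Longrightarrow> y \<in> \<Omega> i \<Longrightarrow> norm (dg i t y *v h) \<le> M * norm h"
  using bounds by (intro norm_matrix_le) (auto simp: game_bounds_def)

lemma constraint_linearization:
  assumes t: "t \<ge> 1" and yz: "y \<in> \<Omega> i" "z \<in> \<Omega> i"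
  shows "g i t y + dg i t y *v (z - y) \<le> g i t z"
proof -
  have yz': "y \<in> act_space D i" "z \<in> act_space D i" using yz action_set(2) by auto
  have "g i t y $ j + (dg i t y *v (z - y)) $ j \<le> g i t z $ j" for j
  proof (rule convex_gradient_le[OF _ yz'])
    show "convex_on (act_space D i) (\<lambda>y. g i t y $ j)"
      using conv_comp t by (auto simp: convexity_compactness_def)
    have "(g i t has_derivative (*v) (dg i t y)) (at y within act_space D i)"
      using derivs t yz' by (auto simp: game_derivatives_def)
    then show "((\<lambda>y. g i t y $ j) has_derivative (\<lambda>h. (dg i t y *v h) $ j)) (at y within act_space D i)"
      by (rule bounded_linear.has_derivative[OF bounded_linear_vec_nth])
  qed
  then show ?thesis by (simp add: less_eq_vec_def)
qed

text \<open>
  The divergence vanishes on the diagonal, so its Lipschitz bound also bounds it by the diameter.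
\<close>
lemma bregman_bound:
  assumes "\<xi> \<in> \<Omega> i" "\<zeta> \<in> \<Omega> i"
  shows "0 \<le> breg i \<xi> \<zeta>" "breg i \<xi> \<zeta> \<le> 2 * L * K"
proof -
  have "\<mu>\<phi> i / 2 * (norm (\<xi> - \<zeta>))\<^sup>2 \<le> breg i \<xi> \<zeta>"
    using generators assms by (intro bregman_ge_quadratic[of "\<Omega> i"]) (auto simp: bregman_generators_def)
  moreover have "0 \<le> \<mu>\<phi> i / 2 * (norm (\<xi> - \<zeta>))\<^sup>2"
    using \<mu>0(1) \<mu>0(2)[of i] by simp
  ultimately show "0 \<le> breg i \<xi> \<zeta>" by simp
  have "breg i \<zeta> \<zeta> = 0" by (simp add: bregman_def)
  then have "breg i \<xi> \<zeta> \<le> K * norm (\<xi> - \<zeta>)"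
    using breg_lip assms unfolding bregman_lipschitz_def
    by (metis abs_le_D1 diff_zero)
  also have "\<dots> \<le> K * (2 * L)" using action_diff_bound assms K by (intro mult_left_mono) auto
  finally show "breg i \<xi> \<zeta> \<le> 2 * L * K" by (simp add: mult.commute)
qed

lemma cost_lipschitz:
  assumes t: "t \<ge> 1" and x: "x \<in> joint_space D" and yz: "y \<in> \<Omega> i" "z \<in> \<Omega> i"
  shows "\<bar>J i t (with_action x i y) - J i t (with_action x i z)\<bar> \<le> M * norm (y - z)"
proof -
  have "norm (J i t (with_action x i y) - J i t (with_action x i z)) \<le> M * norm (y - z)"
  proof (rule differentiable_bound[OF action_set(1) _ _ yz])
    fix w assume w: "w \<in> \<Omega> i"
    let ?G = "dJ i t (with_action x i w)"
    show "((\<lambda>y. J i t (with_action x i y)) has_derivative (\<bullet>) ?G) (at w within \<Omega> i)"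
      using derivs t x w by (auto simp: game_derivatives_def is_gradient_on_def)
    have "with_action x i w \<in> joint_space D" "with_action x i w $ i \<in> \<Omega> i"
      using x w action_set(2) by (auto simp: joint_space_def with_action_def)
    then have "norm ?G \<le> M" by (rule cost_gradient_bound[OF t])
    then have "norm (?G \<bullet> h) \<le> M * norm h" for h
      using Cauchy_Schwarz_ineq2[of ?G h] mult_right_mono[of "norm ?G" M "norm h"] by simp
    then show "onorm ((\<bullet>) ?G) \<le> M" by (rule onorm_le)
  qed
  then show ?thesis by simp
qed

end

section \<open>Iterates and multipliers of one run\<close>

locale online_run = tracking_game +
  fixes T :: nat and X :: "nat \<Rightarrow> 'a \<Rightarrow> real^'b^'a" and Xt lam
  assumes T: "T \<ge> 1"
    and run: "algorithm_run \<Omega> dJ g dg A \<phi> d\<phi>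
              (alpha_step a1) (beta_step a2 T) (gamma_step a2 T) X Xt lam"
begin

definition \<alpha> :: "nat \<Rightarrow> real" where "\<alpha> = alpha_step a1"
definition \<beta> :: real where "\<beta> = 1 / (real T + 1) powr a2"
definition \<gamma> :: real where "\<gamma> = 1 / (real T + 1) powr (1 - a2)"
definition x :: "nat \<Rightarrow> 'a \<Rightarrow> real^'b" where "x t i = X t i $ i"
definition y :: "nat \<Rightarrow> 'a \<Rightarrow> real^'b" where "y t i = Xt (t + 1) i"
definition mix :: "nat \<Rightarrow> 'a \<Rightarrow> real^'c" where "mix t i = mixed_dual A (lam t) i"
definition b :: "nat \<Rightarrow> 'a \<Rightarrow> real^'c" where
  "b t i = dg i t (x t i) *v (y t i - x t i) + g i t (x t i)"

lemma alpha: "0 < \<alpha> t" "\<alpha> t \<le> 1"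
  using a1 by (auto simp: \<alpha>_def alpha_step_def ge_one_powr_ge_zero)

lemma step_bounds: "0 < \<beta>" "0 < \<gamma>" "\<gamma> \<le> 1" "\<gamma> * \<beta> \<le> 1"
proof -
  show "0 < \<beta>" "0 < \<gamma>" by (auto simp: \<beta>_def \<gamma>_def)
  show "\<gamma> \<le> 1" using a2 by (simp add: \<gamma>_def ge_one_powr_ge_zero)
  have "\<beta> \<le> 1" using a2 by (simp add: \<beta>_def ge_one_powr_ge_zero)
  then show "\<gamma> * \<beta> \<le> 1" using \<open>\<gamma> \<le> 1\<close> \<open>0 < \<beta>\<close> \<open>0 < \<gamma>\<close> by (simp add: mult_le_one)
qed

lemma run_init: "x 1 i \<in> \<Omega> i" "h \<noteq> i \<Longrightarrow> X 1 i $ h = 0" "lam 1 i = 0"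
  using run by (auto simp: algorithm_run_def x_def)

lemma run_step:
  assumes "t \<ge> 1"
  shows "h \<noteq> i \<Longrightarrow> X (t + 1) i $ h = (\<Sum>k\<in>UNIV. A $ i $ k *\<^sub>R X t k $ h)"
    and "is_arg_min (\<lambda>v. \<alpha> t * (v \<bullet> (dJ i t (X t i) + \<gamma> *\<^sub>R (transpose (dg i t (x t i)) *v mix t i)))
               + breg i v (x t i)) (\<lambda>v. v \<in> \<Omega> i) (y t i)"
    and "x (t + 1) i = (1 - \<alpha> t) *\<^sub>R x t i + \<alpha> t *\<^sub>R y t i"
    and "lam (t + 1) i = proj_nonneg (mix t i + \<gamma> *\<^sub>R (\<gamma> *\<^sub>R b t i - \<beta> *\<^sub>R mix t i))"
proof -
  have steps: "beta_step a2 T t = \<beta>" "gamma_step a2 T t = \<gamma>"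
    using assms by (auto simp: beta_step_def gamma_step_def \<beta>_def \<gamma>_def)
  note r = run[unfolded algorithm_run_def Let_def, THEN conjunct2, rule_format, OF assms,
      unfolded steps, folded \<alpha>_def x_def y_def mix_def]
  show "h \<noteq> i \<Longrightarrow> X (t + 1) i $ h = (\<Sum>k\<in>UNIV. A $ i $ k *\<^sub>R X t k $ h)"
    using r[of i] by blast
  show "is_arg_min (\<lambda>v. \<alpha> t * (v \<bullet> (dJ i t (X t i) + \<gamma> *\<^sub>R (transpose (dg i t (x t i)) *v mix t i)))
               + breg i v (x t i)) (\<lambda>v. v \<in> \<Omega> i) (y t i)"
    using r[of i] by blast
  show "x (t + 1) i = (1 - \<alpha> t) *\<^sub>R x t i + \<alpha> t *\<^sub>R y t i"
    using r[of i] by blast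
  show "lam (t + 1) i = proj_nonneg (mix t i + \<gamma> *\<^sub>R (\<gamma> *\<^sub>R b t i - \<beta> *\<^sub>R mix t i))"
    using r[of i] unfolding b_def by blast
qed

lemma y_in: "t \<ge> 1 \<Longrightarrow> y t i \<in> \<Omega> i"
  using run_step(2)[of t i] by (simp add: is_arg_min_linorder)

lemma x_in: "t \<ge> 1 \<Longrightarrow> x t i \<in> \<Omega> i"
proof (induction t rule: nat_induct_at_least)
  case base
  show ?case by (rule run_init)
next
  case (Suc t)
  then show ?case
    using run_step(3)[of t i] y_in[of t i] alpha[of t] action_set(1)[of i]
    by (simp add: convexD)
qed

lemma X_joint: "t \<ge> 1 \<Longrightarrow> X t i \<in> joint_space D"
proof (induction t arbitrary: i rule: nat_induct_at_least)
  case base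
  have "X 1 i $ h \<in> act_space D h" for h
    using run_init(1)[of i] run_init(2)[of h i] action_set(2)
    by (cases "h = i") (auto simp: x_def zero_in_act_space)
  then show ?case by (simp add: joint_space_def)
next
  case (Suc t)
  have "X (Suc t) i $ h \<in> act_space D h" for h
  proof (cases "h = i")
    case True
    then show ?thesis using x_in[of "Suc t" i] action_set(2) by (simp add: x_def)
  next
    case False
    then show ?thesis
      using run_step(1)[OF Suc.hyps, of h i] Suc.IH by (simp add: act_space_sum joint_space_def)
  qed
  then show ?case by (simp add: joint_space_def)
qed

lemma actions_nth [simp]: "actions X t $ i = x t i"
  by (simp add: actions_def x_def)

lemma actions_joint: "t \<ge> 1 \<Longrightarrow> actions X t \<in> joint_space D"
  using x_in action_set(2) by (simp add: joint_space_def)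

lemma b_bound: assumes "t \<ge> 1" shows "norm (b t i) \<le> B"
proof -
  have "norm (b t i) \<le> norm (dg i t (x t i) *v (y t i - x t i)) + norm (g i t (x t i))"
    unfolding b_def by (rule norm_triangle_ineq)
  also have "\<dots> \<le> M * norm (y t i - x t i) + L"
    using assms x_in jacobian_bound constraint_bound by (intro add_mono) auto
  also have "\<dots> \<le> M * (2 * L) + L"
    using action_diff_bound[OF y_in[OF assms] x_in[OF assms]] M by simp
  finally show ?thesis by (simp add: B_def)
qed

lemma lam_nonneg: "t \<ge> 1 \<Longrightarrow> 0 \<le> lam t i"
proof (induction t rule: nat_induct_at_least)
  case (Suc t)
  then show ?case using run_step(4)[of t i] by (simp add: proj_nonneg_nonneg)
qed (use run_init(3) in simp)

lemma mix_alt: "mix t i = (\<Sum>j\<in>UNIV. A $ i $ j *\<^sub>R lam t j)"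
  by (simp add: mix_def mixed_dual_def)

lemma mix_nonneg: "t \<ge> 1 \<Longrightarrow> 0 \<le> mix t i"
  unfolding mix_alt using lam_nonneg graph_assumptionD(1)[OF graph]
  by (auto simp: less_eq_vec_def intro!: sum_nonneg mult_nonneg_nonneg)

lemma norm_mix_le: assumes "\<And>j. norm (lam t j) \<le> R" shows "norm (mix t i) \<le> R"
proof -
  have "norm (mix t i) \<le> (\<Sum>j\<in>UNIV. A $ i $ j * norm (lam t j))"
    unfolding mix_alt using graph_assumptionD(1)[OF graph] by (intro sum_norm_le) simp
  also have "\<dots> \<le> (\<Sum>j\<in>UNIV. A $ i $ j * R)"
    using assms graph_assumptionD(1)[OF graph] by (intro sum_mono mult_left_mono) auto
  also have "\<dots> = R" by (simp add: sum_distrib_right[symmetric] graph_assumptionD(3)[OF graph])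
  finally show ?thesis .
qed

text \<open>
  The dual update is a contraction by 1 - \<gamma>\<beta> plus an increment of size \<gamma>^2 B,
  and \<gamma> B / \<beta> is the fixed point of that recursion.
\<close>
lemma lam_bound: "t \<ge> 1 \<Longrightarrow> \<beta> * norm (lam t i) \<le> \<gamma> * B"
proof (induction t arbitrary: i rule: nat_induct_at_least)
  case base
  show ?case unfolding run_init(3) using step_bounds direction_bound_pos by simp
next
  case (Suc t)
  have "norm (lam t j) \<le> \<gamma> * B / \<beta>" for j
    using Suc.IH[of j] step_bounds(1) by (simp add: field_simps)
  then have m: "norm (mix t i) \<le> \<gamma> * B / \<beta>" by (rule norm_mix_le)
  have "norm (lam (t + 1) i) \<le> norm (mix t i + \<gamma> *\<^sub>R (\<gamma> *\<^sub>R b t i - \<beta> *\<^sub>R mix t i))"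
    using proj_nonneg_closer[of 0] run_step(4)[OF Suc.hyps] by simp
  also have "\<dots> = norm ((1 - \<gamma> * \<beta>) *\<^sub>R mix t i + \<gamma>\<^sup>2 *\<^sub>R b t i)"
    by (simp add: algebra_simps power2_eq_square)
  also have "\<dots> \<le> norm ((1 - \<gamma> * \<beta>) *\<^sub>R mix t i) + norm (\<gamma>\<^sup>2 *\<^sub>R b t i)"
    by (rule norm_triangle_ineq)
  also have "\<dots> = (1 - \<gamma> * \<beta>) * norm (mix t i) + \<gamma>\<^sup>2 * norm (b t i)"
    using step_bounds(4) by simp
  also have "\<dots> \<le> (1 - \<gamma> * \<beta>) * (\<gamma> * B / \<beta>) + \<gamma>\<^sup>2 * B"
    using step_bounds m b_bound[OF Suc.hyps] by (intro add_mono mult_left_mono) auto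
  also have "\<dots> = \<gamma> * B / \<beta>"
    using step_bounds(1) by (simp add: field_simps power2_eq_square)
  finally show ?case using step_bounds(1) by (simp add: field_simps)
qed

lemma dual_direction_bound:
  assumes "t \<ge> 1"
  shows "norm (\<gamma> *\<^sub>R b t i - \<beta> *\<^sub>R mix t i) \<le> 2 * \<gamma> * B"
proof -
  have "norm (lam t j) \<le> \<gamma> * B / \<beta>" for j
    using lam_bound[OF assms, of j] step_bounds(1) by (simp add: field_simps)
  then have "norm (mix t i) \<le> \<gamma> * B / \<beta>" by (rule norm_mix_le)
  then have m: "\<beta> * norm (mix t i) \<le> \<gamma> * B" using step_bounds(1) by (simp add: field_simps)
  have "norm (\<gamma> *\<^sub>R b t i - \<beta> *\<^sub>R mix t i) \<le> \<gamma> * norm (b t i) + \<beta> * norm (mix t i)"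
    using norm_triangle_ineq4[of "\<gamma> *\<^sub>R b t i" "\<beta> *\<^sub>R mix t i"] step_bounds by simp
  also have "\<dots> \<le> \<gamma> * B + \<gamma> * B"
    using m b_bound[OF assms, of i] step_bounds by (intro add_mono mult_left_mono) auto
  finally show ?thesis by simp
qed

text \<open>
  Multipliers may grow like \<gamma>/\<beta>, but they enter the increment with weight
  \<gamma>\<beta>, so it is of order \<gamma>^2. This makes the disagreement between the players'
  multipliers small.
\<close>
lemma dual_increment_bound:
  assumes "t \<ge> 1"
  shows "norm (lam (t + 1) i - mix t i) \<le> 2 * \<gamma>\<^sup>2 * B"
proof -
  have "norm (lam (t + 1) i - mix t i) \<le> norm (\<gamma> *\<^sub>R (\<gamma> *\<^sub>R b t i - \<beta> *\<^sub>R mix t i))"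
    using proj_nonneg_closer[OF mix_nonneg[OF assms, of i]] run_step(4)[OF assms, of i]
    by (metis add_diff_cancel_left')
  also have "\<dots> \<le> \<gamma> * (2 * \<gamma> * B)"
    using dual_direction_bound[OF assms, of i] step_bounds by simp
  finally show ?thesis by (simp add: power2_eq_square algebra_simps)
qed

text \<open>
  The dual update is projected gradient ascent on the regularised Lagrangian; since projecting
  onto the orthant does not increase the distance to l \<ge> 0, expanding the square of that
  distance compares mix t i with l. The regularisation costs only \<beta>/2 |l|^2, as the part of
  it that is quadratic in mix t i has a favourable sign.
\<close>
lemma dual_step:
  assumes t: "t \<ge> 1" and l: "0 \<le> l"
  shows "\<gamma> * (l \<bullet> b t i) + ((norm (lam (t + 1) i - l))\<^sup>2 - (norm (mix t i - l))\<^sup>2) / (2 * \<gamma>)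
    \<le> \<gamma> * (mix t i \<bullet> b t i) + \<beta> / 2 * (norm l)\<^sup>2 + 2 * \<gamma>^3 * B\<^sup>2"
proof -
  define w where "w = \<gamma> *\<^sub>R b t i - \<beta> *\<^sub>R mix t i"
  have "norm (lam (t + 1) i - l) \<le> norm (mix t i + \<gamma> *\<^sub>R w - l)"
    using proj_nonneg_closer[OF l] run_step(4)[OF t, of i] by (simp add: w_def)
  then have "(norm (lam (t + 1) i - l))\<^sup>2 \<le> (norm (mix t i + \<gamma> *\<^sub>R w - l))\<^sup>2"
    by (rule power_mono) simp
  also have "\<dots> = (norm (mix t i - l))\<^sup>2 + 2 * \<gamma> * ((mix t i - l) \<bullet> w) + \<gamma>\<^sup>2 * (norm w)\<^sup>2"
    unfolding power2_norm_eq_inner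
    by (simp add: inner_add_left inner_add_right inner_diff_left inner_diff_right inner_commute
        power2_eq_square algebra_simps)
  finally have "((norm (lam (t + 1) i - l))\<^sup>2 - (norm (mix t i - l))\<^sup>2) / (2 * \<gamma>)
      \<le> (2 * \<gamma> * ((mix t i - l) \<bullet> w) + \<gamma>\<^sup>2 * (norm w)\<^sup>2) / (2 * \<gamma>)"
    using step_bounds by (intro divide_right_mono) auto
  also have "\<dots> = (mix t i - l) \<bullet> w + \<gamma> / 2 * (norm w)\<^sup>2"
    using step_bounds by (simp add: field_simps power2_eq_square)
  also have "\<gamma> / 2 * (norm w)\<^sup>2 \<le> \<gamma> / 2 * (2 * \<gamma> * B)\<^sup>2"
    using dual_direction_bound[OF t, of i] step_bounds unfolding w_def
    by (intro mult_left_mono power_mono) auto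
  also have "\<gamma> / 2 * (2 * \<gamma> * B)\<^sup>2 = 2 * \<gamma>^3 * B\<^sup>2"
    by (simp add: power2_eq_square power3_eq_cube)
  finally have 1: "((norm (lam (t + 1) i - l))\<^sup>2 - (norm (mix t i - l))\<^sup>2) / (2 * \<gamma>)
      \<le> (mix t i - l) \<bullet> w + 2 * \<gamma>^3 * B\<^sup>2" by simp
  \<comment> \<open>Polarisation: 2 (m - l) . m + |l|^2 = |m|^2 + |m - l|^2 for m = mix t i.\<close>
  have "0 \<le> \<beta> / 2 * ((norm (mix t i))\<^sup>2 + (norm (mix t i - l))\<^sup>2)"
    using step_bounds by simp
  also have "\<dots> = \<beta> * ((mix t i - l) \<bullet> mix t i) + \<beta> / 2 * (norm l)\<^sup>2"
    unfolding power2_norm_eq_inner by (simp add: inner_diff_left inner_diff_right inner_commute field_simps)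
  finally have "(mix t i - l) \<bullet> w \<le> \<gamma> * ((mix t i - l) \<bullet> b t i) + \<beta> / 2 * (norm l)\<^sup>2"
    by (simp add: w_def inner_diff_right)
  with 1 show ?thesis by (simp add: inner_diff_left right_diff_distrib)
qed

section \<open>Disagreement between the players\<close>

definition mean_dual :: "nat \<Rightarrow> real^'c" where
  "mean_dual t = (1 / N) *\<^sub>R (\<Sum>j\<in>UNIV. lam t j)"

text \<open>
  The deviations of the multipliers from their mean, stacked; they sum to zero.
\<close>
definition dual_spread :: "nat \<Rightarrow> real^'c^'a" where
  "dual_spread t = (\<chi> i. lam t i - mean_dual t)"

text \<open>
  The errors of all players about the action of player h. The component of h itself is zero, which
  is what makes averaging contract them.
\<close>
definition estimate_error :: "'a \<Rightarrow> nat \<Rightarrow> real^'b^'a" where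
  "estimate_error h t = (\<chi> i. X t i $ h - x t h)"

lemma row_sum_scaleR: "(\<Sum>k\<in>UNIV. A $ i $ k *\<^sub>R (v::'v::real_vector)) = v"
  by (simp add: scaleR_sum_left[symmetric] graph_assumptionD(3)[OF graph])

lemma average_dual_spread: "average A (dual_spread t) $ i = mix t i - mean_dual t"
  by (simp add: average_def dual_spread_def scaleR_diff_right sum_subtractf row_sum_scaleR mix_alt)

lemma sum_mix: "(\<Sum>i\<in>UNIV. mix t i) = (\<Sum>j\<in>UNIV. lam t j)"
proof -
  have "(\<Sum>i\<in>UNIV. mix t i) = (\<Sum>j\<in>UNIV. \<Sum>i\<in>UNIV. A $ j $ i *\<^sub>R lam t j)"
    unfolding mix_alt by (subst sum.swap) (simp add: graph_assumptionD(4)[OF graph])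
  then show ?thesis by (simp add: row_sum_scaleR)
qed

lemma sum_const_N: "(\<Sum>i\<in>(UNIV::'a set). c) = N * (c::real)"
  by (simp add: N)

lemma dual_spread_sum: "(\<Sum>i\<in>UNIV. dual_spread t $ i) = 0"
proof -
  have "(\<Sum>i\<in>(UNIV::'a set). mean_dual t) = N *\<^sub>R mean_dual t" by (simp only: sum_constant_scaleR N)
  then show ?thesis using N_ge_1 by (simp add: dual_spread_def sum_subtractf mean_dual_def)
qed

lemma norm_average_dual_spread: "norm (average A (dual_spread t)) \<le> \<sigma> * norm (dual_spread t)"
  using dual_spread_sum by (intro average_contraction[OF \<sigma>(1) contraction]) auto

text \<open>
  Averaging preserves the mean, so the mean moves only by the mean of the increments, and the
  spread is the contracted spread plus the increments centred at their mean.
\<close>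
lemma dual_spread_step:
  assumes t: "t \<ge> 1"
  shows "norm (dual_spread (t + 1)) \<le> \<sigma> * norm (dual_spread t) + 4 * N * \<gamma>\<^sup>2 * B"
proof -
  define e where "e i = lam (t + 1) i - mix t i" for i
  define m where "m = (1 / N) *\<^sub>R (\<Sum>i\<in>UNIV. e i)"
  have e: "norm (e i) \<le> 2 * \<gamma>\<^sup>2 * B" for i
    unfolding e_def by (rule dual_increment_bound[OF t])
  have "norm (\<Sum>i\<in>UNIV. e i) \<le> N * (2 * \<gamma>\<^sup>2 * B)"
    unfolding sum_const_N[symmetric] using e by (intro sum_norm_le) auto
  then have m: "norm m \<le> 2 * \<gamma>\<^sup>2 * B"
    using N_ge_1 by (simp add: m_def field_simps)
  have mean: "mean_dual (t + 1) = mean_dual t + m"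
    by (simp add: mean_dual_def m_def e_def sum_subtractf sum_mix algebra_simps)
  have "dual_spread (t + 1) $ i = (average A (dual_spread t) + (\<chi> i. e i - m)) $ i" for i
    unfolding vector_add_component average_dual_spread
    by (simp only: dual_spread_def e_def mean vec_lambda_beta) simp
  then have "dual_spread (t + 1) = average A (dual_spread t) + (\<chi> i. e i - m)"
    by (simp add: vec_eq_iff[where 'b = 'a])
  then have "norm (dual_spread (t + 1)) \<le> norm (average A (dual_spread t)) + norm (\<chi> i. e i - m)"
    by (simp add: norm_triangle_ineq)
  moreover have "norm (\<chi> i. e i - m) \<le> N * (4 * \<gamma>\<^sup>2 * B)"
  proof -
    have "norm (e i - m) \<le> 4 * \<gamma>\<^sup>2 * B" for i
      using norm_triangle_ineq4[of "e i" m] e[of i] m by simp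
    then have "(\<Sum>i\<in>UNIV. norm (e i - m)) \<le> N * (4 * \<gamma>\<^sup>2 * B)"
      unfolding sum_const_N[symmetric] by (intro sum_mono)
    then show ?thesis using norm_vec_le_sum[of "\<chi> i. e i - m"] by simp
  qed
  ultimately show ?thesis using norm_average_dual_spread[of t] by (simp add: mult.assoc)
qed

lemma sum_dual_spread:
  "(\<Sum>t=1..T. norm (dual_spread t)) \<le> 4 * N * \<gamma>\<^sup>2 * B * T / (1 - \<sigma>)"
proof -
  have "dual_spread 1 = 0"
    using run_init(3) by (simp add: dual_spread_def mean_dual_def vec_eq_iff)
  moreover have "(\<Sum>t=1..T. norm (dual_spread t))
      \<le> (norm (dual_spread 1) + (\<Sum>t=1..T. 4 * N * \<gamma>\<^sup>2 * B)) / (1 - \<sigma>)"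
    by (rule sum_geometric_recursion[OF \<sigma>])
      (use N_ge_1 direction_bound_pos dual_spread_step in auto)
  ultimately show ?thesis by (simp add: mult.commute)
qed

text \<open>
  With a common multiplier the left-hand side would be nonpositive, since the equilibrium is
  feasible for the shared constraint, although its summands have no sign individually. Only the
  disagreement of the multipliers remains.
\<close>
lemma mixed_dual_feasible_point:
  assumes t: "t \<ge> 1"
  shows "(\<Sum>i\<in>UNIV. mix t i \<bullet> g i t (xs t $ i)) \<le> L * N * norm (dual_spread t)"
proof -
  have "mean_dual t \<ge> 0" unfolding mean_dual_def less_eq_vec_def
    using lam_nonneg[OF t] N_ge_1 by (auto simp: less_eq_vec_def intro!: sum_nonneg divide_nonneg_pos)
  then have "0 \<le> mean_dual t \<bullet> (- shared_constraint g t (xs t))"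
    using xs_feasible(2)[OF t] by (intro inner_nonneg_nonneg) auto
  then have mean: "mean_dual t \<bullet> (\<Sum>i\<in>UNIV. g i t (xs t $ i)) \<le> 0"
    by (simp add: shared_constraint_def)
  have dev: "(mix t i - mean_dual t) \<bullet> g i t (xs t $ i) \<le> norm (dual_spread t) * L" for i
  proof -
    have "norm (mix t i - mean_dual t) \<le> norm (average A (dual_spread t))"
      using Finite_Cartesian_Product.norm_nth_le[of "average A (dual_spread t)" i] by (simp add: average_dual_spread)
    also have "\<dots> \<le> \<sigma> * norm (dual_spread t)" by (rule norm_average_dual_spread)
    also have "\<dots> \<le> norm (dual_spread t)" using \<sigma> by (simp add: mult_left_le_one_le)
    finally have "norm (mix t i - mean_dual t) * norm (g i t (xs t $ i)) \<le> norm (dual_spread t) * L"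
      using constraint_bound[OF t xs_feasible(1)[OF t, of i]] by (intro mult_mono) auto
    then show ?thesis using norm_cauchy_schwarz order_trans by blast
  qed
  have "(\<Sum>i\<in>UNIV. mix t i \<bullet> g i t (xs t $ i))
      = mean_dual t \<bullet> (\<Sum>i\<in>UNIV. g i t (xs t $ i)) + (\<Sum>i\<in>UNIV. (mix t i - mean_dual t) \<bullet> g i t (xs t $ i))"
    by (simp add: inner_diff_left inner_sum_right sum_subtractf)
  also have "\<dots> \<le> 0 + (\<Sum>i\<in>(UNIV::'a set). norm (dual_spread t) * L)"
    using mean dev by (intro add_mono sum_mono) auto
  finally show ?thesis unfolding sum_const_N by (simp add: mult_ac)
qed

text \<open>
  The other players average their estimates of h while h moves by at most 2 L \<alpha> t, and the
  component of h is reset to zero, which does not increase the norm.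
\<close>
lemma estimate_error_step:
  assumes t: "t \<ge> 1"
  shows "norm (estimate_error h (t + 1)) \<le> \<sigma> * norm (estimate_error h t) + 2 * L * N * \<alpha> t"
proof -
  define U where "U = (\<chi> i. if i = h then 0 else average A (estimate_error h t) $ i)"
  define V where "V = (\<chi> i. if i = h then 0 else - \<alpha> t *\<^sub>R (y t h - x t h))"
  have avg: "average A (estimate_error h t) $ i = (\<Sum>k\<in>UNIV. A $ i $ k *\<^sub>R X t k $ h) - x t h" for i
    by (simp add: average_def estimate_error_def scaleR_diff_right sum_subtractf row_sum_scaleR)
  have "estimate_error h (t + 1) $ i = (U + V) $ i" for i
  proof (cases "i = h")
    case True
    then show ?thesis by (simp add: estimate_error_def U_def V_def x_def)
  next
    case False
    then have "estimate_error h (t + 1) $ i = (\<Sum>k\<in>UNIV. A $ i $ k *\<^sub>R X t k $ h)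
        - ((1 - \<alpha> t) *\<^sub>R x t h + \<alpha> t *\<^sub>R y t h)"
      using run_step(1)[OF t, of h i] run_step(3)[OF t, of h] by (simp add: estimate_error_def)
    then show ?thesis using False
      by (simp add: U_def V_def avg algebra_simps)
  qed
  then have "norm (estimate_error h (t + 1)) \<le> norm U + norm V"
    by (metis norm_triangle_ineq vec_eq_iff)
  moreover have "norm U \<le> norm (average A (estimate_error h t))"
    by (rule norm_le_componentwise_cart) (simp add: U_def)
  moreover have "norm (average A (estimate_error h t)) \<le> \<sigma> * norm (estimate_error h t)"
    by (rule average_contraction[OF \<sigma>(1) contraction, where h = h])
      (auto simp: estimate_error_def x_def)
  moreover have "norm V \<le> 2 * L * N * \<alpha> t"
  proof -
    have "\<alpha> t * norm (y t h - x t h) \<le> \<alpha> t * (2 * L)"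
      using action_diff_bound[OF y_in[OF t] x_in[OF t]] alpha[of t] by (intro mult_left_mono) auto
    then have "norm (V $ i) \<le> \<alpha> t * (2 * L)" for i
      using alpha[of t] L by (simp add: V_def)
    then have "(\<Sum>i\<in>UNIV. norm (V $ i)) \<le> N * (\<alpha> t * (2 * L))"
      unfolding sum_const_N[symmetric] by (intro sum_mono)
    then show ?thesis using norm_vec_le_sum[of V] by (simp add: mult_ac)
  qed
  ultimately show ?thesis by linarith
qed

lemma sum_alpha_ge_1: "1 \<le> (\<Sum>t=1..T. \<alpha> t)"
proof -
  have "\<alpha> 1 \<le> (\<Sum>t=1..T. \<alpha> t)"
    using T alpha by (intro member_le_sum) (auto simp: less_imp_le)
  then show ?thesis by (simp add: \<alpha>_def alpha_step_def)
qed

lemma sum_estimate_error: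
  "(\<Sum>t=1..T. norm (estimate_error h t)) \<le> 3 * L * N / (1 - \<sigma>) * (\<Sum>t=1..T. \<alpha> t)"
proof -
  have "norm (estimate_error h 1 $ i) \<le> L" for i
  proof (cases "i = h")
    case True
    then show ?thesis using L by (simp add: estimate_error_def x_def)
  next
    case False
    then show ?thesis using run_init(2)[of h i] action_set(3)[OF run_init(1)[of h]]
      by (simp add: estimate_error_def)
  qed
  then have "(\<Sum>i\<in>UNIV. norm (estimate_error h 1 $ i)) \<le> N * L"
    unfolding sum_const_N[symmetric] by (intro sum_mono)
  then have init: "norm (estimate_error h 1) \<le> N * L"
    using norm_vec_le_sum[of "estimate_error h 1"] by simp
  have "(\<Sum>t=1..T. norm (estimate_error h t))
      \<le> (norm (estimate_error h 1) + (\<Sum>t=1..T. 2 * L * N * \<alpha> t)) / (1 - \<sigma>)"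
    by (rule sum_geometric_recursion[OF \<sigma>])
      (use N_ge_1 L alpha estimate_error_step in \<open>auto simp: less_imp_le\<close>)
  also have "\<dots> \<le> (3 * L * N * (\<Sum>t=1..T. \<alpha> t)) / (1 - \<sigma>)"
  proof (rule divide_right_mono)
    \<comment> \<open>The initial error is absorbed because the first step size is 1.\<close>
    have "N * L * 1 \<le> N * L * (\<Sum>t=1..T. \<alpha> t)"
      using sum_alpha_ge_1 N_ge_1 L by (intro mult_left_mono) auto
    then show "norm (estimate_error h 1) + (\<Sum>t=1..T. 2 * L * N * \<alpha> t) \<le> 3 * L * N * (\<Sum>t=1..T. \<alpha> t)"
      using init by (simp add: sum_distrib_left[symmetric] algebra_simps)
  qed (use \<sigma> in simp)
  finally show ?thesis by simp
qed

lemma estimate_gap: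
  "norm (X t i - actions X t) \<le> (\<Sum>h\<in>UNIV. norm (estimate_error h t))"
proof -
  have "norm (X t i - actions X t) \<le> (\<Sum>h\<in>UNIV. norm ((X t i - actions X t) $ h))"
    by (rule norm_vec_le_sum)
  also have "\<dots> \<le> (\<Sum>h\<in>UNIV. norm (estimate_error h t))"
  proof (rule sum_mono)
    fix h
    show "norm ((X t i - actions X t) $ h) \<le> norm (estimate_error h t)"
      using Finite_Cartesian_Product.norm_nth_le[of "estimate_error h t" i] by (simp add: estimate_error_def)
  qed
  finally show ?thesis .
qed

section \<open>The energy inequality of one step\<close>

definition bregman_decrease :: "'a \<Rightarrow> nat \<Rightarrow> real" where
  "bregman_decrease i t
    = (breg i (xs t $ i) (x t i) - breg i (xs t $ i) (x (t + 1) i)) / (\<alpha> t)\<^sup>2"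

text \<open>
  The primal and the dual step of one player, added. Linearising the constraint at x t i, the
  primal step produces the inner product of mix t i with exactly the vector b t i that the dual
  step uses, so the two cancel and the comparator l takes the place of mix t i. Everything linear
  in the move |y - x| is absorbed by the quadratic term of the mirror step; since that term has
  weight 1/\<alpha>, the cost is proportional to \<alpha>.
\<close>
lemma player_step:
  assumes t: "t \<ge> 1" and l: "0 \<le> l"
  shows "(x t i - xs t $ i) \<bullet> dJ i t (actions X t) + \<gamma> * (l \<bullet> g i t (x t i))
      + ((norm (lam (t + 1) i - l))\<^sup>2 - (norm (mix t i - l))\<^sup>2) / (2 * \<gamma>)
    \<le> bregman_decrease i t + \<gamma> * (mix t i \<bullet> g i t (xs t $ i))
      + 2 * L * H * (\<Sum>h\<in>UNIV. norm (estimate_error h t))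
      + \<beta> / 2 * (norm l)\<^sup>2 + 2 * \<gamma>^3 * B\<^sup>2
      + \<alpha> t * (M\<^sup>2 / \<mu>0 * (1 + \<gamma>\<^sup>2 * (norm l)\<^sup>2))"
proof -
  define \<delta> where "\<delta> = norm (y t i - x t i)"
  let ?xs = "xs t $ i" and ?G = "dJ i t (X t i)" and ?F = "dJ i t (actions X t)"
  let ?dg = "dg i t (x t i)"
  note in_set = x_in[OF t, of i] y_in[OF t, of i] xs_feasible(1)[OF t, of i]
  have "(y t i - ?xs) \<bullet> (?G + \<gamma> *\<^sub>R (transpose ?dg *v mix t i))
        + \<mu>\<phi> i / (2 * \<alpha> t) * \<delta>\<^sup>2 \<le> bregman_decrease i t"
    unfolding bregman_decrease_def \<delta>_def
    using generators breg_conv in_set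
    by (intro mirror_step_inequality[OF action_set(1)[of i] _ _ _ alpha[of t] _ _
        run_step(2)[OF t, of i] run_step(3)[OF t, of i]])
      (auto simp: bregman_generators_def bregman_convex_def)
  moreover have "\<mu>0 / (2 * \<alpha> t) * \<delta>\<^sup>2 \<le> \<mu>\<phi> i / (2 * \<alpha> t) * \<delta>\<^sup>2"
    using \<mu>0(2)[of i] alpha[of t] by (intro mult_right_mono divide_right_mono) auto
  moreover have "(y t i - ?xs) \<bullet> (?G + \<gamma> *\<^sub>R (transpose ?dg *v mix t i))
      = (y t i - ?xs) \<bullet> ?G + \<gamma> * (mix t i \<bullet> (?dg *v (y t i - ?xs)))"
    by (simp only: inner_add_right inner_scaleR_right inner_transpose)
  ultimately have mirror: "(y t i - ?xs) \<bullet> ?G + \<gamma> * (mix t i \<bullet> (?dg *v (y t i - ?xs)))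
      + \<mu>0 / (2 * \<alpha> t) * \<delta>\<^sup>2 \<le> bregman_decrease i t" by linarith
  have cost: "(x t i - ?xs) \<bullet> ?F - 2 * L * H * (\<Sum>h\<in>UNIV. norm (estimate_error h t)) - M * \<delta>
      \<le> (y t i - ?xs) \<bullet> ?G"
  proof -
    have xi: "X t i $ i \<in> \<Omega> i" using in_set(1) by (simp add: x_def)
    have "norm (?F - ?G) \<le> H * norm (X t i - actions X t)"
      using lip_grad t X_joint[OF t, of i] actions_joint[OF t] xi in_set(1)
      unfolding lipschitz_gradients_def
      by (metis actions_nth norm_minus_commute)
    also have "\<dots> \<le> H * (\<Sum>h\<in>UNIV. norm (estimate_error h t))"
      using estimate_gap[of t i] H by (intro mult_left_mono) auto
    finally have "norm (x t i - ?xs) * norm (?F - ?G)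
        \<le> (2 * L) * (H * (\<Sum>h\<in>UNIV. norm (estimate_error h t)))"
      using action_diff_bound[OF in_set(1,3)] L by (intro mult_mono) auto
    then have "(x t i - ?xs) \<bullet> (?F - ?G) \<le> 2 * L * H * (\<Sum>h\<in>UNIV. norm (estimate_error h t))"
      using norm_cauchy_schwarz[of "x t i - ?xs" "?F - ?G"] by (simp add: mult_ac)
    moreover have "- ((y t i - x t i) \<bullet> ?G) \<le> M * \<delta>"
      using Cauchy_Schwarz_ineq2[of "y t i - x t i" ?G]
        mult_left_mono[OF cost_gradient_bound[OF t X_joint[OF t] xi], of \<delta>]
      by (simp add: \<delta>_def mult.commute)
    ultimately show ?thesis by (simp add: inner_diff_left inner_diff_right)
  qed
  \<comment> \<open>Convexity of the constraint at the comparator and the sign of the multiplier.\<close>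
  have constr: "\<gamma> * (mix t i \<bullet> b t i) - \<gamma> * (mix t i \<bullet> g i t ?xs)
      \<le> \<gamma> * (mix t i \<bullet> (?dg *v (y t i - ?xs)))"
  proof -
    have "0 \<le> g i t ?xs - (g i t (x t i) + ?dg *v (?xs - x t i))"
      using constraint_linearization[OF t in_set(1,3)] by (simp add: less_eq_vec_def)
    from inner_nonneg_nonneg[OF mix_nonneg[OF t, of i] this]
    have "mix t i \<bullet> (b t i - g i t ?xs) \<le> mix t i \<bullet> (?dg *v (y t i - ?xs))"
      by (simp add: b_def inner_diff_right inner_add_right matrix_vector_mult_diff_distrib)
    then show ?thesis
      using step_bounds(2) by (simp add: inner_diff_right right_diff_distrib[symmetric])
  qed
  have comp: "\<gamma> * (l \<bullet> g i t (x t i)) - \<gamma> * norm l * M * \<delta> \<le> \<gamma> * (l \<bullet> b t i)"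
  proof -
    have "norm l * norm (?dg *v (y t i - x t i)) \<le> norm l * (M * \<delta>)"
      unfolding \<delta>_def using jacobian_bound[OF t in_set(1)] by (intro mult_left_mono) auto
    then have "- (l \<bullet> (?dg *v (y t i - x t i))) \<le> norm l * (M * \<delta>)"
      using Cauchy_Schwarz_ineq2[of l "?dg *v (y t i - x t i)"] by simp
    then have "\<gamma> * (- (l \<bullet> (?dg *v (y t i - x t i)))) \<le> \<gamma> * (norm l * (M * \<delta>))"
      using step_bounds(2) by (intro mult_left_mono) auto
    then show ?thesis by (simp add: b_def inner_add_right algebra_simps)
  qed
  \<comment> \<open>Completing the square in the length of the move.\<close>
  have quad: "(M + \<gamma> * norm l * M) * \<delta> - \<mu>0 / (2 * \<alpha> t) * \<delta>\<^sup>2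
      \<le> \<alpha> t * (M\<^sup>2 / \<mu>0 * (1 + \<gamma>\<^sup>2 * (norm l)\<^sup>2))"
  proof -
    have "(M + \<gamma> * norm l * M) * \<delta> - \<mu>0 / (2 * \<alpha> t) * \<delta>\<^sup>2
        \<le> (M + \<gamma> * norm l * M)\<^sup>2 / (4 * (\<mu>0 / (2 * \<alpha> t)))"
      by (rule linear_minus_quadratic_le) (use \<mu>0(1) alpha[of t] in simp)
    also have "\<dots> = \<alpha> t * (M\<^sup>2 / \<mu>0 * ((1 + \<gamma> * norm l)\<^sup>2 / 2))"
      using \<mu>0(1) alpha[of t] by (simp add: field_simps power2_eq_square)
    also have "(1 + \<gamma> * norm l)\<^sup>2 / 2 \<le> 1 + \<gamma>\<^sup>2 * (norm l)\<^sup>2"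
      using zero_le_power2[of "1 - \<gamma> * norm l"] by (simp add: power2_eq_square algebra_simps)
    finally show ?thesis using alpha[of t] \<mu>0(1)
      by (simp add: mult_left_mono divide_right_mono)
  qed
  have "(M + \<gamma> * norm l * M) * \<delta> = M * \<delta> + \<gamma> * norm l * M * \<delta>" by (simp add: algebra_simps)
  with quad mirror cost constr comp dual_step[OF t l, of i] show ?thesis by linarith
qed

text \<open>
  Strong monotonicity compares the current gradients with those at the equilibrium. The
  variational inequality there does not cover infeasible actions, but its multiplier form does, at
  the price of the term with the multiplier. The weight \<gamma> of that term makes the
  Cauchy-Schwarz bound sufficient, as \<gamma> T is at most T^a2.
\<close>
lemma variational_lower_bound:
  assumes t: "t \<in> {1..T}"
  shows "\<mu> * (norm (actions X t - xs t))\<^sup>2 - 2 * N * \<gamma> * \<Lambda> * M * L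
    \<le> (\<Sum>i\<in>UNIV. (x t i - xs t $ i) \<bullet> dJ i t (actions X t))"
proof -
  have t1: "t \<ge> 1" using t by simp
  have "gamma_step a2 T t = \<gamma>" using t by (simp add: gamma_step_def \<gamma>_def)
  then obtain l where mult: "weighted_multiplier \<Omega> dJ dg t (xs t) \<gamma> l" and l: "norm l \<le> \<Lambda>"
    using multipliers T t by metis
  have "- (2 * \<gamma> * \<Lambda> * M * L) \<le> (x t i - xs t $ i) \<bullet> dJ i t (xs t)" for i
  proof -
    note in_set = x_in[OF t1, of i] xs_feasible(1)[OF t1, of i]
    let ?d = "x t i - xs t $ i"
    have "(xs t $ i - x t i) \<bullet> (dJ i t (xs t) + \<gamma> *\<^sub>R (transpose (dg i t (xs t $ i)) *v l)) \<le> 0"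
      using mult in_set by (simp add: weighted_multiplier_def)
    then have "- (\<gamma> * (l \<bullet> (dg i t (xs t $ i) *v ?d))) \<le> ?d \<bullet> dJ i t (xs t)"
      by (simp add: inner_add_right inner_diff_left inner_transpose[symmetric] right_diff_distrib)
    moreover have "l \<bullet> (dg i t (xs t $ i) *v ?d) \<le> \<Lambda> * (M * (2 * L))"
    proof -
      have "l \<bullet> (dg i t (xs t $ i) *v ?d) \<le> norm l * norm (dg i t (xs t $ i) *v ?d)"
        by (rule norm_cauchy_schwarz)
      also have "\<dots> \<le> \<Lambda> * (M * norm ?d)"
        using l jacobian_bound[OF t1 in_set(2), of ?d] \<Lambda> by (intro mult_mono) auto
      also have "\<dots> \<le> \<Lambda> * (M * (2 * L))"
        using \<Lambda> M action_diff_bound[OF in_set] by (intro mult_left_mono) auto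
      finally show ?thesis .
    qed
    then have "\<gamma> * (l \<bullet> (dg i t (xs t $ i) *v ?d)) \<le> \<gamma> * (\<Lambda> * (M * (2 * L)))"
      using step_bounds(2) by (intro mult_left_mono) auto
    ultimately show ?thesis by (simp add: algebra_simps)
  qed
  then have "(\<Sum>i\<in>(UNIV::'a set). - (2 * \<gamma> * \<Lambda> * M * L)) \<le> (\<Sum>i\<in>UNIV. (x t i - xs t $ i) \<bullet> dJ i t (xs t))"
    by (intro sum_mono)
  then have opt: "- (2 * N * \<gamma> * \<Lambda> * M * L) \<le> (\<Sum>i\<in>UNIV. (x t i - xs t $ i) \<bullet> dJ i t (xs t))"
    unfolding sum_const_N by (simp add: algebra_simps)
  have "\<mu> * (norm (actions X t - xs t))\<^sup>2
      \<le> (pseudo_gradient dJ t (actions X t) - pseudo_gradient dJ t (xs t)) \<bullet> (actions X t - xs t)"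
    using str_mono t1 x_in[OF t1] xs_feasible(1)[OF t1] by (simp add: strongly_monotone_def)
  also have "\<dots> = (\<Sum>i\<in>UNIV. (x t i - xs t $ i) \<bullet> dJ i t (actions X t))
      - (\<Sum>i\<in>UNIV. (x t i - xs t $ i) \<bullet> dJ i t (xs t))"
    by (subst inner_vec_def)
      (simp add: pseudo_gradient_def inner_diff_left inner_diff_right inner_commute
        sum_subtractf sum.distrib algebra_simps)
  finally show ?thesis using opt by linarith
qed

text \<open>
  The energy of the multipliers relative to a comparator; averaging does not increase it.
\<close>
definition drift :: "real^'c \<Rightarrow> nat \<Rightarrow> real" where
  "drift l t = (\<Sum>i\<in>UNIV. (norm (lam t i - l))\<^sup>2)"

lemma game_step:
  assumes t: "t \<in> {1..T}" and l: "0 \<le> l"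
  shows "\<mu> * (norm (actions X t - xs t))\<^sup>2 + \<gamma> * (l \<bullet> shared_constraint g t (actions X t))
      + (drift l (t + 1) - drift l t) / (2 * \<gamma>)
    \<le> (\<Sum>i\<in>UNIV. bregman_decrease i t)
      + 2 * L * H * N * (\<Sum>h\<in>UNIV. norm (estimate_error h t))
      + \<gamma> * L * N * norm (dual_spread t)
      + N * M\<^sup>2 / \<mu>0 * (1 + \<gamma>\<^sup>2 * (norm l)\<^sup>2) * \<alpha> t
      + (2 * N * \<gamma> * \<Lambda> * M * L + 2 * N * \<gamma>^3 * B\<^sup>2 + N * \<beta> / 2 * (norm l)\<^sup>2)"
proof -
  have t1: "t \<ge> 1" using t by simp
  let ?e = "\<Sum>h\<in>UNIV. norm (estimate_error h t)"
  define R where "R = 2 * L * H * ?e + \<beta> / 2 * (norm l)\<^sup>2 + 2 * \<gamma>^3 * B\<^sup>2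
      + \<alpha> t * (M\<^sup>2 / \<mu>0 * (1 + \<gamma>\<^sup>2 * (norm l)\<^sup>2))"
  have "(\<Sum>i\<in>UNIV. (x t i - xs t $ i) \<bullet> dJ i t (actions X t) + \<gamma> * (l \<bullet> g i t (x t i))
      + ((norm (lam (t + 1) i - l))\<^sup>2 - (norm (mix t i - l))\<^sup>2) / (2 * \<gamma>))
    \<le> (\<Sum>i\<in>UNIV. bregman_decrease i t + \<gamma> * (mix t i \<bullet> g i t (xs t $ i)) + R)"
    using player_step[OF t1 l] by (intro sum_mono) (simp add: R_def algebra_simps)
  then have sum: "(\<Sum>i\<in>UNIV. (x t i - xs t $ i) \<bullet> dJ i t (actions X t))
      + \<gamma> * (l \<bullet> shared_constraint g t (actions X t))
      + (drift l (t + 1) - (\<Sum>i\<in>UNIV. (norm (mix t i - l))\<^sup>2)) / (2 * \<gamma>)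
    \<le> (\<Sum>i\<in>UNIV. bregman_decrease i t) + \<gamma> * (\<Sum>i\<in>UNIV. mix t i \<bullet> g i t (xs t $ i)) + N * R"
    unfolding sum.distrib sum_const_N
    by (simp only: shared_constraint_def drift_def inner_sum_right sum_distrib_left sum_divide_distrib
        sum_subtractf actions_nth diff_divide_distrib)
  have mixed: "(\<Sum>i\<in>UNIV. (norm (mix t i - l))\<^sup>2) \<le> drift l t"
  proof -
    have "mix t i - l = (\<Sum>k\<in>UNIV. A $ i $ k *\<^sub>R (lam t k - l))" for i
      by (simp add: scaleR_diff_right sum_subtractf row_sum_scaleR mix_alt)
    then show ?thesis
      unfolding drift_def using averaging_nonexpansive[OF graph, of "\<lambda>k. lam t k - l"] by simp
  qed
  have "(drift l (t + 1) - drift l t) / (2 * \<gamma>)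
      \<le> (drift l (t + 1) - (\<Sum>i\<in>UNIV. (norm (mix t i - l))\<^sup>2)) / (2 * \<gamma>)"
    using mixed step_bounds(2) by (intro divide_right_mono) auto
  moreover have "\<gamma> * (\<Sum>i\<in>UNIV. mix t i \<bullet> g i t (xs t $ i)) \<le> \<gamma> * (L * N * norm (dual_spread t))"
    using mixed_dual_feasible_point[OF t1] step_bounds(2) by (intro mult_left_mono) auto
  moreover have "N * R = 2 * L * H * N * ?e + N * M\<^sup>2 / \<mu>0 * (1 + \<gamma>\<^sup>2 * (norm l)\<^sup>2) * \<alpha> t
      + (2 * N * \<gamma>^3 * B\<^sup>2 + N * \<beta> / 2 * (norm l)\<^sup>2)"
    by (simp add: R_def algebra_simps)
  ultimately show ?thesis using sum variational_lower_bound[OF t] by (simp add: mult.assoc)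
qed

section \<open>Summation over the horizon\<close>

lemma path_length_nonneg: "0 \<le> path_length xs T"
  by (simp add: path_length_def sum_nonneg)

text \<open>
  The weights 1/\<alpha>^2 increase, and the equilibrium moves between consecutive divergences;
  Lipschitz continuity in the first argument charges that motion to the path length.
\<close>
lemma sum_bregman_decrease:
  "(\<Sum>t=1..T. bregman_decrease i t) \<le> 1 / (\<alpha> T)\<^sup>2 * (K * (2 * L + path_length xs T))"
proof -
  let ?a = "\<lambda>t. breg i (xs t $ i) (x t i)" and ?a' = "\<lambda>t. breg i (xs t $ i) (x (t + 1) i)"
  let ?d = "\<lambda>t. K * norm (xs (t + 1) - xs t)"
  have mono: "\<alpha> (Suc t) \<le> \<alpha> t" for t
    using a1 alpha[of "Suc t"]
    by (cases "t = 0") (auto simp: \<alpha>_def alpha_step_def intro!: divide_left_mono powr_mono2)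
  have "(\<Sum>t=1..T. 1 / (\<alpha> t)\<^sup>2 * (?a t - ?a' t))
      \<le> 1 / (\<alpha> T)\<^sup>2 * (2 * L * K - ?a (T + 1) + (\<Sum>t=1..T. ?d t))"
  proof (rule weighted_telescope)
    fix t
    show "1 / (\<alpha> t)\<^sup>2 \<le> 1 / (\<alpha> (Suc t))\<^sup>2"
      using alpha[of t] alpha[of "Suc t"] mono[of t] by (intro divide_left_mono power_mono) auto
  next
    fix t :: nat assume t: "t \<ge> 1"
    show "?a t \<le> 2 * L * K" by (rule bregman_bound(2)[OF xs_feasible(1) x_in]) (use t in auto)
    have "?a (Suc t) - ?a' t \<le> K * norm (xs (t + 1) $ i - xs t $ i)"
      using breg_lip xs_feasible(1)[of "Suc t" i] xs_feasible(1)[OF t, of i] x_in[of "Suc t" i]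
      unfolding bregman_lipschitz_def by (force dest: abs_le_D1)
    also have "\<dots> \<le> ?d t"
      using Finite_Cartesian_Product.norm_nth_le[of "xs (t + 1) - xs t" i] K
      by (intro mult_left_mono) auto
    finally show "?a (Suc t) - ?a' t \<le> ?d t" .
  qed (use K in auto)
  also have "\<dots> \<le> 1 / (\<alpha> T)\<^sup>2 * (K * (2 * L + path_length xs T))"
    using bregman_bound(1)[OF xs_feasible(1)[of "T + 1" i] x_in[of "T + 1" i]]
    by (intro mult_left_mono)
      (auto simp: path_length_def sum_distrib_left[symmetric] algebra_simps)
  finally show ?thesis by (simp add: bregman_decrease_def)
qed

end

text \<open>
  Subadditivity of the square root, with the constant 4 that both applications produce.
\<close>
lemma le_of_square_le:
  fixes s c u v \<phi> :: real
  assumes "s\<^sup>2 \<le> c * (4 * u\<^sup>2 + v\<^sup>2 * \<phi>)" "0 \<le> c" "0 \<le> u" "0 \<le> v" "0 \<le> \<phi>"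
  shows "s \<le> sqrt c * (2 * u + v * sqrt \<phi>)"
proof -
  have "(sqrt c * (2 * u + v * sqrt \<phi>))\<^sup>2 = c * (4 * u\<^sup>2 + v\<^sup>2 * \<phi> + 4 * u * v * sqrt \<phi>)"
    using assms by (simp add: power_mult_distrib power2_sum algebra_simps)
  also have "\<dots> \<ge> c * (4 * u\<^sup>2 + v\<^sup>2 * \<phi>)" using assms by (intro mult_left_mono) auto
  finally have "s\<^sup>2 \<le> (sqrt c * (2 * u + v * sqrt \<phi>))\<^sup>2" using assms(1) by linarith
  then show ?thesis by (rule power2_le_imp_le) (use assms in simp)
qed

text \<open>
  Induction on T; the increment of T^(1 - a) is bounded below by weighted arithmetic-geometric
  means, and the factor 2 exceeds 1/(1 - a).
\<close>
lemma sum_powr_le: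
  fixes a :: real
  assumes "0 < a" "a < 1 / 2"
  shows "(\<Sum>t=1..T. 1 / real t powr a) \<le> 2 * real T powr (1 - a)"
proof (induction T)
  case (Suc T)
  define s where "s = real T + 1"
  have s: "s > 0" by (simp add: s_def)
  have "real T powr (1 - a) * s powr a \<le> (1 - a) * real T + a * s"
  proof (cases "T = 0")
    case False
    then show ?thesis by (intro Youngs_inequality_0) (use assms s in auto)
  qed (use assms s in simp)
  also have "\<dots> \<le> s - 1 / 2" using assms by (simp add: s_def algebra_simps)
  finally have "1 \<le> 2 * (s - real T powr (1 - a) * s powr a)" by simp
  also have "\<dots> = 2 * (s powr (1 - a) - real T powr (1 - a)) * s powr a"
    using s powr_add[of s "1 - a" a] by (simp add: algebra_simps)
  finally have "1 / s powr a \<le> 2 * (s powr (1 - a) - real T powr (1 - a))"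
    using s by (simp add: field_simps)
  then show ?case using Suc.IH by (simp add: s_def add.commute)
qed simp

text \<open>
  The multiplier \<gamma>/(2 Q) maximises c \<mapsto> \<gamma> c s^2 - Q (c s)^2, with value
  \<gamma>^2 s^2 / (4 Q).
\<close>
lemma quadratic_comparator:
  fixes \<gamma> Q P s :: real
  assumes "0 < \<gamma>" "0 < Q"
    and le: "\<gamma> * (\<gamma> / (2 * Q) * s\<^sup>2) - Q * (\<gamma> / (2 * Q) * s)\<^sup>2 \<le> P"
  shows "s\<^sup>2 \<le> 4 * P * (Q / \<gamma>\<^sup>2)"
proof -
  have "Q * (\<gamma> / (2 * Q) * s)\<^sup>2 = \<gamma> / 2 * (\<gamma> / (2 * Q) * s\<^sup>2)"
    using assms by (simp add: power2_eq_square)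
  with le have "\<gamma> / 2 * (\<gamma> / (2 * Q) * s\<^sup>2) \<le> P" by simp
  then have "4 * (Q / \<gamma>\<^sup>2) * (\<gamma> / 2 * (\<gamma> / (2 * Q) * s\<^sup>2)) \<le> 4 * (Q / \<gamma>\<^sup>2) * P"
    using assms by (intro mult_left_mono) auto
  moreover have "4 * (Q / \<gamma>\<^sup>2) * (\<gamma> / 2 * (\<gamma> / (2 * Q) * s\<^sup>2)) = s\<^sup>2"
    using assms by (simp add: power2_eq_square)
  ultimately show ?thesis by (simp add: mult_ac)
qed

context tracking_game
begin

text \<open>
  The summands are the coefficients collected from the divergences, the estimates, the
  disagreement of the multipliers, the absorbed moves, the equilibrium multipliers and the dual
  step, in this order.
\<close>
definition primal_const :: real where
  "primal_const = N * K * (2 * L + 1) + 6 * L\<^sup>2 * H * N^3 / (1 - \<sigma>) + 4 * L * N\<^sup>2 * B / (1 - \<sigma>)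
    + N * M\<^sup>2 / \<mu>0 + 2 * N * \<Lambda> * M * L + 2 * N * B\<^sup>2"

definition dual_const :: real where "dual_const = N + N * M\<^sup>2 / \<mu>0"

lemma constants_pos: "0 < primal_const" "0 < dual_const"
  using N_ge_1 K L H M \<mu>0(1) \<sigma> \<Lambda> direction_bound_pos by (auto simp: primal_const_def dual_const_def intro!: add_pos_nonneg)

end

context online_run
begin

text \<open>
  The whole analysis in one estimate with a free comparator l \<ge> 0. The first bracket collects
  what is paid without l, the second one the price of l: the initial dual energy 1/\<gamma>, the
  regularisation \<beta> T, and the moves of the players paired with l.
\<close>
lemma master_inequality:
  assumes l: "0 \<le> l"
  shows "\<mu> * (\<Sum>t=1..T. (norm (actions X t - xs t))\<^sup>2)
      + \<gamma> * (l \<bullet> (\<Sum>t=1..T. shared_constraint g t (actions X t)))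
    \<le> primal_const * (1 / (\<alpha> T)\<^sup>2 * (1 + path_length xs T) + (\<Sum>t=1..T. \<alpha> t) + \<gamma> * T)
      + dual_const * (1 / \<gamma> + \<beta> * T + \<gamma>\<^sup>2 * (\<Sum>t=1..T. \<alpha> t)) * (norm l)\<^sup>2"
proof -
  define \<Phi> where "\<Phi> = path_length xs T"
  define w where "w = 1 / (\<alpha> T)\<^sup>2"
  define s where "s = (\<Sum>t=1..T. \<alpha> t)"
  define e where "e = (\<Sum>t=1..T. \<Sum>h\<in>UNIV. norm (estimate_error h t))"
  define ds where "ds = (\<Sum>t=1..T. norm (dual_spread t))"
  define brg where "brg = (\<Sum>t=1..T. \<Sum>i\<in>UNIV. bregman_decrease i t)"
  define n2 where "n2 = (norm l)\<^sup>2"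
  have nonneg: "0 \<le> \<Phi>" "0 \<le> w" "1 \<le> s" "0 \<le> n2"
    using path_length_nonneg sum_alpha_ge_1 by (auto simp: \<Phi>_def w_def s_def n2_def)
  have steps: "(\<Sum>t=1..T. \<mu> * (norm (actions X t - xs t))\<^sup>2 + \<gamma> * (l \<bullet> shared_constraint g t (actions X t))
      + (drift l (t + 1) - drift l t) / (2 * \<gamma>))
    \<le> (\<Sum>t=1..T. (\<Sum>i\<in>UNIV. bregman_decrease i t)
      + 2 * L * H * N * (\<Sum>h\<in>UNIV. norm (estimate_error h t))
      + \<gamma> * L * N * norm (dual_spread t)
      + N * M\<^sup>2 / \<mu>0 * (1 + \<gamma>\<^sup>2 * (norm l)\<^sup>2) * \<alpha> t
      + (2 * N * \<gamma> * \<Lambda> * M * L + 2 * N * \<gamma>^3 * B\<^sup>2 + N * \<beta> / 2 * (norm l)\<^sup>2))"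
    by (intro sum_mono game_step l)
  have rhs: "(\<Sum>t=1..T. (\<Sum>i\<in>UNIV. bregman_decrease i t)
      + 2 * L * H * N * (\<Sum>h\<in>UNIV. norm (estimate_error h t))
      + \<gamma> * L * N * norm (dual_spread t)
      + N * M\<^sup>2 / \<mu>0 * (1 + \<gamma>\<^sup>2 * (norm l)\<^sup>2) * \<alpha> t
      + (2 * N * \<gamma> * \<Lambda> * M * L + 2 * N * \<gamma>^3 * B\<^sup>2 + N * \<beta> / 2 * (norm l)\<^sup>2))
    = brg + 2 * L * H * N * e + \<gamma> * L * N * ds + N * M\<^sup>2 / \<mu>0 * (1 + \<gamma>\<^sup>2 * n2) * s
      + T * (2 * N * \<gamma> * \<Lambda> * M * L + 2 * N * \<gamma>^3 * B\<^sup>2 + N * \<beta> / 2 * n2)"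
    unfolding sum.distrib sum_distrib_left[symmetric]
    by (simp add: brg_def e_def ds_def s_def n2_def algebra_simps)
  have total: "\<mu> * (\<Sum>t=1..T. (norm (actions X t - xs t))\<^sup>2)
      + \<gamma> * (l \<bullet> (\<Sum>t=1..T. shared_constraint g t (actions X t)))
      + (\<Sum>t=1..T. drift l (t + 1) - drift l t) / (2 * \<gamma>)
    \<le> brg + 2 * L * H * N * e + \<gamma> * L * N * ds + N * M\<^sup>2 / \<mu>0 * (1 + \<gamma>\<^sup>2 * n2) * s
      + T * (2 * N * \<gamma> * \<Lambda> * M * L + 2 * N * \<gamma>^3 * B\<^sup>2 + N * \<beta> / 2 * n2)"
    using steps unfolding rhs
    by (simp only: sum.distrib sum_distrib_left[symmetric] sum_divide_distrib[symmetric]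
        inner_sum_right[symmetric])
  have dr: "- (N * n2 / \<gamma>) \<le> (\<Sum>t=1..T. drift l (t + 1) - drift l t) / (2 * \<gamma>)"
  proof -
    have "(\<Sum>t=1..T. drift l (t + 1) - drift l t) = drift l (T + 1) - drift l 1"
      using sum_Suc_diff[of 1 T "drift l"] by simp
    moreover have "drift l 1 = N * n2" using run_init(3) by (simp add: drift_def n2_def N)
    moreover have "0 \<le> drift l (T + 1)" by (simp add: drift_def sum_nonneg)
    ultimately have "- (N * n2) / (2 * \<gamma>) \<le> (\<Sum>t=1..T. drift l (t + 1) - drift l t) / (2 * \<gamma>)"
      using step_bounds(2) by (intro divide_right_mono) auto
    moreover have "N * n2 / (2 * \<gamma>) \<le> N * n2 / \<gamma>"
      using N_ge_1 nonneg step_bounds(2) by (intro divide_left_mono) auto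
    ultimately show ?thesis by simp
  qed
  have brg: "brg \<le> N * K * (2 * L + 1) * (w * (1 + \<Phi>))"
  proof -
    have "brg = (\<Sum>i\<in>UNIV. \<Sum>t=1..T. bregman_decrease i t)" unfolding brg_def by (rule sum.swap)
    also have "\<dots> \<le> N * (w * (K * (2 * L + \<Phi>)))"
      unfolding sum_const_N[symmetric] w_def \<Phi>_def by (intro sum_mono sum_bregman_decrease)
    also have "\<dots> \<le> N * (w * (K * ((2 * L + 1) * (1 + \<Phi>))))"
      using N_ge_1 nonneg K L by (intro mult_left_mono) (auto simp: algebra_simps)
    finally show ?thesis by (simp add: mult_ac)
  qed
  have e: "2 * L * H * N * e \<le> 6 * L\<^sup>2 * H * N^3 / (1 - \<sigma>) * s"
  proof -
    have "e = (\<Sum>h\<in>UNIV. \<Sum>t=1..T. norm (estimate_error h t))" unfolding e_def by (rule sum.swap)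
    also have "\<dots> \<le> N * (3 * L * N / (1 - \<sigma>) * s)"
      unfolding sum_const_N[symmetric] s_def by (intro sum_mono sum_estimate_error)
    finally have "2 * L * H * N * e \<le> 2 * L * H * N * (N * (3 * L * N / (1 - \<sigma>) * s))"
      using L H N_ge_1 by (intro mult_left_mono) auto
    then show ?thesis by (simp add: power2_eq_square power3_eq_cube mult_ac)
  qed
  \<comment> \<open>Every higher power of \<gamma> is absorbed into the summand \<gamma> T.\<close>
  have cube: "\<gamma>^3 \<le> \<gamma>"
    using power_decreasing[of 1 3 \<gamma>] step_bounds by simp
  have ds: "\<gamma> * L * N * ds \<le> 4 * L * N\<^sup>2 * B / (1 - \<sigma>) * (\<gamma> * T)"
  proof -
    have "\<gamma> * L * N * ds \<le> \<gamma> * L * N * (4 * N * \<gamma>\<^sup>2 * B * T / (1 - \<sigma>))"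
      using sum_dual_spread L N_ge_1 step_bounds unfolding ds_def by (intro mult_left_mono) auto
    also have "\<dots> = (4 * L * N\<^sup>2 * B / (1 - \<sigma>) * T) * \<gamma>^3"
      by (simp add: power2_eq_square power3_eq_cube mult_ac)
    also have "\<dots> \<le> (4 * L * N\<^sup>2 * B / (1 - \<sigma>) * T) * \<gamma>"
      using cube L N_ge_1 direction_bound_pos \<sigma> by (intro mult_left_mono) auto
    finally show ?thesis by (simp add: mult_ac)
  qed
  have cub: "T * (2 * N * \<gamma>^3 * B\<^sup>2) \<le> 2 * N * B\<^sup>2 * (\<gamma> * T)"
  proof -
    have "(2 * N * B\<^sup>2 * T) * \<gamma>^3 \<le> (2 * N * B\<^sup>2 * T) * \<gamma>"
      using cube N_ge_1 by (intro mult_left_mono) auto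
    then show ?thesis by (simp add: mult_ac)
  qed
  have prods: "0 \<le> w * (1 + \<Phi>)" "0 \<le> s" "0 \<le> \<gamma> * T" "0 \<le> n2 / \<gamma>" "0 \<le> \<beta> * T * n2" "0 \<le> \<gamma>\<^sup>2 * s * n2"
    using nonneg step_bounds by auto
  \<comment> \<open>With named coefficients the final combination is linear arithmetic.\<close>
  define c1 where "c1 = N * K * (2 * L + 1)"
  define c2 where "c2 = 6 * L\<^sup>2 * H * N^3 / (1 - \<sigma>)"
  define c3 where "c3 = 4 * L * N\<^sup>2 * B / (1 - \<sigma>)"
  define c4 where "c4 = N * M\<^sup>2 / \<mu>0"
  define c5 where "c5 = 2 * N * \<Lambda> * M * L"
  define c6 where "c6 = 2 * N * B\<^sup>2"
  have cs: "0 \<le> c1" "0 \<le> c2" "0 \<le> c3" "0 \<le> c4" "0 \<le> c5" "0 \<le> c6"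
    using N_ge_1 K L H M \<mu>0(1) \<sigma> \<Lambda> direction_bound_pos
    by (auto simp: c1_def c2_def c3_def c4_def c5_def c6_def)
  have P: "c1 * (w * (1 + \<Phi>)) + c2 * s + c3 * (\<gamma> * T) + c4 * s + c5 * (\<gamma> * T) + c6 * (\<gamma> * T)
      \<le> primal_const * (w * (1 + \<Phi>) + s + \<gamma> * T)"
  proof -
    have "c1 * (w * (1 + \<Phi>)) \<le> primal_const * (w * (1 + \<Phi>))"
      "(c2 + c4) * s \<le> primal_const * s" "(c3 + c5 + c6) * (\<gamma> * T) \<le> primal_const * (\<gamma> * T)"
      using cs prods unfolding primal_const_def c1_def[symmetric] c2_def[symmetric] c3_def[symmetric]
        c4_def[symmetric] c5_def[symmetric] c6_def[symmetric]
      by (auto intro!: mult_right_mono)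
    then show ?thesis by (simp add: algebra_simps)
  qed
  have Q: "N * n2 / \<gamma> + N * (\<beta> * T * n2) / 2 + c4 * (\<gamma>\<^sup>2 * s * n2)
      \<le> dual_const * (1 / \<gamma> + \<beta> * T + \<gamma>\<^sup>2 * s) * n2"
  proof -
    have "N \<le> dual_const" "N / 2 \<le> dual_const" "c4 \<le> dual_const"
      using cs N_ge_1 unfolding dual_const_def c4_def[symmetric] by auto
    from this[THEN mult_right_mono] prods(4-6)
    have "N * (n2 / \<gamma>) \<le> dual_const * (n2 / \<gamma>)" "N / 2 * (\<beta> * T * n2) \<le> dual_const * (\<beta> * T * n2)"
      "c4 * (\<gamma>\<^sup>2 * s * n2) \<le> dual_const * (\<gamma>\<^sup>2 * s * n2)" by blast+
    then show ?thesis by (simp add: algebra_simps)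
  qed
  have "N * M\<^sup>2 / \<mu>0 * (1 + \<gamma>\<^sup>2 * n2) * s = c4 * s + c4 * (\<gamma>\<^sup>2 * s * n2)"
    by (simp add: c4_def algebra_simps)
  moreover have "T * (2 * N * \<gamma> * \<Lambda> * M * L + 2 * N * \<gamma>^3 * B\<^sup>2 + N * \<beta> / 2 * n2)
      = c5 * (\<gamma> * T) + T * (2 * N * \<gamma>^3 * B\<^sup>2) + N * (\<beta> * T * n2) / 2"
    by (simp add: c5_def algebra_simps)
  ultimately show ?thesis
    using total dr brg e ds cub P Q
    unfolding c1_def[symmetric] c2_def[symmetric] c3_def[symmetric] c6_def[symmetric]
      \<Phi>_def[symmetric] w_def[symmetric] s_def[symmetric] n2_def[symmetric]
    by linarith
qed

text \<open>
  The step sizes \<beta> and \<gamma> involve T + 1; the only place where the shift is harmful is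
  1/\<gamma>, where it costs a factor 2.
\<close>
lemma step_size_growth:
  shows "1 / (\<alpha> T)\<^sup>2 = real T powr (2 * a1)"
    and "(\<Sum>t=1..T. \<alpha> t) \<le> 2 * real T powr (1 - a1)"
    and "\<gamma> * T \<le> real T powr a2"
    and "1 / \<gamma> \<le> 2 * real T powr (1 - a2)"
    and "\<beta> * T \<le> real T powr (1 - a2)"
proof -
  have T0: "0 < real T" using T by simp
  show "1 / (\<alpha> T)\<^sup>2 = real T powr (2 * a1)"
    using T by (simp add: \<alpha>_def alpha_step_def power_divide powr_realpow[symmetric] powr_powr mult.commute)
  have "(\<Sum>t=1..T. \<alpha> t) = (\<Sum>t=1..T. 1 / real t powr a1)"
    by (intro sum.cong) (auto simp: \<alpha>_def alpha_step_def)
  then show "(\<Sum>t=1..T. \<alpha> t) \<le> 2 * real T powr (1 - a1)"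
    using sum_powr_le[OF a1, of T] by simp
  have split: "real T powr c * real T powr (1 - c) = T" for c
    using T0 by (simp add: powr_add[symmetric])
  have "1 / (real T + 1) powr c \<le> 1 / real T powr c" if "0 < c" for c
    using that T0 by (intro divide_left_mono powr_mono2) auto
  moreover have "1 / real T powr c * T = real T powr (1 - c)" for c
    using split[of c] T0 by (simp add: field_simps)
  ultimately have le: "1 / (real T + 1) powr c * T \<le> real T powr (1 - c)" if "0 < c" for c
    using that by (metis mult_right_mono of_nat_0_le_iff)
  show "\<gamma> * T \<le> real T powr a2" using le[of "1 - a2"] a2 by (simp add: \<gamma>_def)
  show "\<beta> * T \<le> real T powr (1 - a2)" using le[of a2] a2 by (simp add: \<beta>_def)
  have "(real T + 1) powr (1 - a2) \<le> (2 * real T) powr (1 - a2)"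
    using a2 T by (intro powr_mono2) auto
  also have "\<dots> = 2 powr (1 - a2) * real T powr (1 - a2)" by (simp add: powr_mult)
  also have "\<dots> \<le> 2 powr 1 * real T powr (1 - a2)"
    using a2 by (intro mult_right_mono powr_mono) auto
  finally show "1 / \<gamma> \<le> 2 * real T powr (1 - a2)" by (simp add: \<gamma>_def)
qed

lemma powr_le: "p \<le> q \<Longrightarrow> real T powr p \<le> real T powr q"
  using T by (intro powr_mono) auto

lemma powr_split: "real T * real T powr p = real T powr (1 + p)"
  "(real T powr p)\<^sup>2 = real T powr (2 * p)"
  using T by (simp_all add: powr_add powr_realpow[symmetric] powr_powr mult.commute)

lemma primal_budget:
  "1 / (\<alpha> T)\<^sup>2 * (1 + path_length xs T) + (\<Sum>t=1..T. \<alpha> t) + \<gamma> * T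
    \<le> real T powr (2 * a1) + 2 * real T powr (1 - a1) + real T powr a2
      + real T powr (2 * a1) * path_length xs T"
  using step_size_growth by (simp add: algebra_simps)

section \<open>Regret and constraint violation\<close>

text \<open>
  Costs are Lipschitz in the own action, so the regret is at most M times the summed distance to
  the equilibria. Cauchy-Schwarz in time reduces this to the squared distances, which the master
  inequality with l = 0 bounds.
\<close>
lemma regret_bound:
  assumes q: "1 / 2 + a1 \<le> q" "1 / 2 + a2 / 2 \<le> q" "1 - a1 / 2 \<le> q"
  shows "\<bar>regret J xs (actions X) i T\<bar>
    \<le> M * sqrt (primal_const / \<mu>) * (2 * real T powr q + real T powr (1 / 2 + a1) * sqrt (path_length xs T))"
proof -
  let ?\<Phi> = "path_length xs T" and ?d = "\<lambda>t. norm (actions X t - xs t)"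
  have "\<bar>regret J xs (actions X) i T\<bar>
      \<le> (\<Sum>t=1..T. \<bar>J i t (with_action (xs t) i (x t i)) - J i t (xs t)\<bar>)"
    unfolding regret_def by (simp add: sum_abs)
  also have "\<dots> \<le> (\<Sum>t=1..T. M * ?d t)"
  proof (rule sum_mono)
    fix t assume "t \<in> {1..T}"
    then have t: "t \<ge> 1" by simp
    have "with_action (xs t) i (xs t $ i) = xs t" by (simp add: with_action_def vec_eq_iff)
    then have "\<bar>J i t (with_action (xs t) i (x t i)) - J i t (xs t)\<bar> \<le> M * norm (x t i - xs t $ i)"
      using cost_lipschitz[OF t xs_feasible(3)[OF t] x_in[OF t] xs_feasible(1)[OF t], of i] by simp
    also have "\<dots> \<le> M * ?d t"
      using Finite_Cartesian_Product.norm_nth_le[of "actions X t - xs t" i] M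
      by (intro mult_left_mono) auto
    finally show "\<bar>J i t (with_action (xs t) i (x t i)) - J i t (xs t)\<bar> \<le> M * ?d t" .
  qed
  finally have reg: "\<bar>regret J xs (actions X) i T\<bar> \<le> M * (\<Sum>t=1..T. ?d t)"
    by (simp add: sum_distrib_left)
  have "\<mu> * (\<Sum>t=1..T. (?d t)\<^sup>2)
      \<le> primal_const * (1 / (\<alpha> T)\<^sup>2 * (1 + ?\<Phi>) + (\<Sum>t=1..T. \<alpha> t) + \<gamma> * T)"
    using master_inequality[of 0] by simp
  also have "\<dots> \<le> primal_const * (real T powr (2 * a1) + 2 * real T powr (1 - a1)
      + real T powr a2 + real T powr (2 * a1) * ?\<Phi>)"
    using primal_budget constants_pos by (intro mult_left_mono) auto
  finally have track: "(\<Sum>t=1..T. (?d t)\<^sup>2) \<le> primal_const / \<mu> * (real T powr (2 * a1) + 2 * real T powr (1 - a1)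
      + real T powr a2 + real T powr (2 * a1) * ?\<Phi>)"
    using \<mu> by (simp add: field_simps)
  have "(\<Sum>t=1..T. ?d t)\<^sup>2 \<le> T * (\<Sum>t=1..T. (?d t)\<^sup>2)"
    using sum_squared_le_sum_of_squares[of ?d "{1..T}"] by (simp add: mult.commute)
  also have "\<dots> \<le> T * (primal_const / \<mu> * (real T powr (2 * a1) + 2 * real T powr (1 - a1)
      + real T powr a2 + real T powr (2 * a1) * ?\<Phi>))"
    using track by (intro mult_left_mono) auto
  also have "\<dots> = primal_const / \<mu> * (real T powr (1 + 2 * a1) + 2 * real T powr (1 + (1 - a1))
      + real T powr (1 + a2) + real T powr (1 + 2 * a1) * ?\<Phi>)"
    unfolding powr_split(1)[symmetric] by (simp add: algebra_simps)
  also have "\<dots> \<le> primal_const / \<mu> * (4 * (real T powr q)\<^sup>2 + (real T powr (1 / 2 + a1))\<^sup>2 * ?\<Phi>)"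
  proof (rule mult_left_mono)
    have "real T powr (1 + 2 * a1) \<le> real T powr (2 * q)" "real T powr (1 + (1 - a1)) \<le> real T powr (2 * q)"
      "real T powr (1 + a2) \<le> real T powr (2 * q)"
      using q by (auto intro!: powr_le)
    moreover have "2 * (1 / 2 + a1) = 1 + 2 * a1" by simp
    ultimately show "real T powr (1 + 2 * a1) + 2 * real T powr (1 + (1 - a1))
        + real T powr (1 + a2) + real T powr (1 + 2 * a1) * ?\<Phi>
      \<le> 4 * (real T powr q)\<^sup>2 + (real T powr (1 / 2 + a1))\<^sup>2 * ?\<Phi>"
      unfolding powr_split(2) by simp
  qed (use constants_pos \<mu> in simp)
  finally have "(\<Sum>t=1..T. ?d t)
      \<le> sqrt (primal_const / \<mu>) * (2 * real T powr q + real T powr (1 / 2 + a1) * sqrt ?\<Phi>)"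
    by (rule le_of_square_le) (use constants_pos \<mu> path_length_nonneg in auto)
  then have "M * (\<Sum>t=1..T. ?d t)
      \<le> M * (sqrt (primal_const / \<mu>) * (2 * real T powr q + real T powr (1 / 2 + a1) * sqrt ?\<Phi>))"
    using M by (intro mult_left_mono) auto
  with reg show ?thesis by (simp add: mult.assoc)
qed

text \<open>
  With f the larger of 1 - a1/2 and 2 - 3 a2/2, the exponents 3 - 3 a2 and 1 - a1 that arise are
  both at most 2 f - 1.
\<close>
lemma dual_budget:
  "(1 / \<gamma> + \<beta> * T + \<gamma>\<^sup>2 * (\<Sum>t=1..T. \<alpha> t)) / \<gamma>\<^sup>2
    \<le> 14 * real T powr (2 * max (1 - a1 / 2) (2 - 3 / 2 * a2) - 1)"
proof -
  let ?f = "max (1 - a1 / 2) (2 - 3 / 2 * a2)" and ?u = "real T powr (1 - a2)"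
  have f: "1 - a1 / 2 \<le> ?f" "2 - 3 / 2 * a2 \<le> ?f" by auto
  have "(1 / \<gamma>)\<^sup>2 \<le> (2 * ?u)\<^sup>2"
    using step_size_growth(4) step_bounds(2) by (intro power_mono) auto
  then have "(1 / \<gamma> + \<beta> * T) * (1 / \<gamma>)\<^sup>2 \<le> (2 * ?u + ?u) * (2 * ?u)\<^sup>2"
    using step_size_growth(4,5) step_bounds by (intro mult_mono add_mono) auto
  also have "\<dots> = 12 * real T powr (3 - 3 * a2)"
  proof -
    have "?u * ?u\<^sup>2 = real T powr (3 - 3 * a2)"
      unfolding powr_split(2) powr_add[symmetric] by (rule arg_cong[where f = "(powr) (real T)"]) simp
    then show ?thesis by (simp add: power_mult_distrib)
  qed
  also have "real T powr (3 - 3 * a2) \<le> real T powr (2 * ?f - 1)"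
    by (rule powr_le) (use f(2) in argo)
  finally have 1: "(1 / \<gamma> + \<beta> * T) * (1 / \<gamma>)\<^sup>2 \<le> 12 * real T powr (2 * ?f - 1)" by simp
  have "real T powr (1 - a1) \<le> real T powr (2 * ?f - 1)"
    by (rule powr_le) (use f(1) in argo)
  then have 2: "(\<Sum>t=1..T. \<alpha> t) \<le> 2 * real T powr (2 * ?f - 1)"
    using step_size_growth(2) by linarith
  have "(1 / \<gamma> + \<beta> * T + \<gamma>\<^sup>2 * (\<Sum>t=1..T. \<alpha> t)) / \<gamma>\<^sup>2
      = (1 / \<gamma> + \<beta> * T) * (1 / \<gamma>)\<^sup>2 + (\<Sum>t=1..T. \<alpha> t)"
    using step_bounds(2) by (simp add: field_simps)
  then show ?thesis using 1 2 by linarith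
qed

text \<open>
  The comparator is a multiple of the projected total constraint p, for which l \<bullet> S is at
  least that multiple of |p|^2; optimising the multiple gives |p|^2 \<le> 4 P Q / \<gamma>^2.
  Since 2 a1, 1 - a1 and a2 are at most 1, P is at most of order T + T^(2 a1) \<Phi>, and the
  second exponent is f - 1/2 + a1, where f is the first one.
\<close>
lemma violation_bound:
  "constraint_violation g (actions X) T
    \<le> sqrt (56 * primal_const * dual_const) * (2 * real T powr max (1 - a1 / 2) (2 - 3 / 2 * a2)
        + real T powr max (1 / 2 + a1 / 2) (3 / 2 + a1 - 3 * a2 / 2) * sqrt (path_length xs T))"
proof -
  let ?f = "max (1 - a1 / 2) (2 - 3 / 2 * a2)" and ?e = "max (1 / 2 + a1 / 2) (3 / 2 + a1 - 3 * a2 / 2)"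
  let ?\<Phi> = "path_length xs T"
  define S where "S = (\<Sum>t=1..T. shared_constraint g t (actions X t))"
  define p where "p = proj_nonneg S"
  define P where "P = primal_const * (4 * T + real T powr (2 * a1) * ?\<Phi>)"
  define R where "R = 1 / \<gamma> + \<beta> * T + \<gamma>\<^sup>2 * (\<Sum>t=1..T. \<alpha> t)"
  define Q where "Q = dual_const * R"
  have "0 < R" unfolding R_def
    using step_bounds sum_alpha_ge_1 by (intro add_pos_nonneg) auto
  then have Q: "0 < Q" using constants_pos by (simp add: Q_def)
  define c where "c = \<gamma> / (2 * Q)"
  have c: "0 \<le> c" using Q step_bounds(2) by (simp add: c_def)
  have "0 \<le> c *\<^sub>R p"
    using proj_nonneg_nonneg[of S] c by (auto simp: p_def less_eq_vec_def)
  note master = master_inequality[OF this]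
  have "primal_const * (1 / (\<alpha> T)\<^sup>2 * (1 + ?\<Phi>) + (\<Sum>t=1..T. \<alpha> t) + \<gamma> * T) \<le> P"
  proof -
    have "real T powr (2 * a1) + 2 * real T powr (1 - a1) + real T powr a2 \<le> 4 * real T"
      using powr_le[of "2 * a1" 1] powr_le[of "1 - a1" 1] powr_le[of a2 1] a1 a2 by simp
    then show ?thesis unfolding P_def
      using primal_budget constants_pos by (intro mult_left_mono) auto
  qed
  moreover have "0 \<le> \<mu> * (\<Sum>t=1..T. (norm (actions X t - xs t))\<^sup>2)"
    using \<mu> by (simp add: sum_nonneg)
  ultimately have "\<gamma> * (c * (p \<bullet> S)) \<le> P + Q * (c * norm p)\<^sup>2"
    using master c unfolding S_def[symmetric] R_def[symmetric] Q_def by simp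
  moreover have "\<gamma> * (c * (norm p)\<^sup>2) \<le> \<gamma> * (c * (p \<bullet> S))"
    using norm_proj_nonneg_le_inner[of S] c step_bounds(2) unfolding p_def
    by (intro mult_left_mono) auto
  ultimately have "\<gamma> * (c * (norm p)\<^sup>2) - Q * (c * norm p)\<^sup>2 \<le> P" by linarith
  from quadratic_comparator[OF step_bounds(2) Q this[unfolded c_def]]
  have "(norm p)\<^sup>2 \<le> 4 * P * (Q / \<gamma>\<^sup>2)" .
  also have "\<dots> = 4 * P * dual_const * (R / \<gamma>\<^sup>2)" by (simp add: Q_def)
  also have "\<dots> \<le> 4 * P * dual_const * (14 * real T powr (2 * ?f - 1))"
    using dual_budget constants_pos path_length_nonneg unfolding R_def P_def
    by (intro mult_left_mono) auto
  also have "\<dots> = 56 * primal_const * dual_const * (4 * (T * real T powr (2 * ?f - 1))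
      + real T powr (2 * a1) * real T powr (2 * ?f - 1) * ?\<Phi>)"
    by (simp add: P_def algebra_simps)
  also have "T * real T powr (2 * ?f - 1) = (real T powr ?f)\<^sup>2"
    unfolding powr_split by (rule arg_cong[where f = "(powr) (real T)"]) simp
  also have "real T powr (2 * a1) * real T powr (2 * ?f - 1) = (real T powr ?e)\<^sup>2"
    unfolding powr_split powr_add[symmetric]
    by (rule arg_cong[where f = "(powr) (real T)"]) (simp add: max_def field_simps)
  finally have "norm p \<le> sqrt (56 * primal_const * dual_const) * (2 * real T powr ?f + real T powr ?e * sqrt ?\<Phi>)"
    by (rule le_of_square_le) (use constants_pos path_length_nonneg in auto)
  then show ?thesis by (simp add: constraint_violation_def p_def S_def)
qed

end

theorem theorem1:
  fixes D :: "'p::finite \<Rightarrow> ('d::finite) set"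
    and \<Omega> :: "'p \<Rightarrow> (real^'d) set"
    and J :: "'p \<Rightarrow> nat \<Rightarrow> real^'d^'p \<Rightarrow> real"
    and dJ :: "'p \<Rightarrow> nat \<Rightarrow> real^'d^'p \<Rightarrow> real^'d"
    and g :: "'p \<Rightarrow> nat \<Rightarrow> real^'d \<Rightarrow> real^'m::finite"
    and dg :: "'p \<Rightarrow> nat \<Rightarrow> real^'d \<Rightarrow> real^'d^'m"
    and E :: "('p \<times> 'p) set"
    and A :: "real^'p^'p"
    and \<phi> :: "'p \<Rightarrow> real^'d \<Rightarrow> real"
    and d\<phi> :: "'p \<Rightarrow> real^'d \<Rightarrow> real^'d"
    and \<mu>\<phi> :: "'p \<Rightarrow> real"
    and xs :: "nat \<Rightarrow> real^'d^'p"
    and L M K H \<mu> \<Lambda> a1 a2 :: real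
  assumes graph: "graph_assumption E A"
    and generators: "bregman_generators \<Omega> \<phi> d\<phi> \<mu>\<phi>"
    and "K > 0" and breg_lip: "bregman_lipschitz \<Omega> \<phi> d\<phi> K"
    and breg_conv: "bregman_convex \<Omega> \<phi> d\<phi>"
    and conv_comp: "convexity_compactness D \<Omega> J g"
    and derivs: "game_derivatives D \<Omega> J dJ g dg"
    and "L > 0" and "M > 0" and bounds: "game_bounds D \<Omega> J dJ g dg L M"
    and "H > 0" and lip_grad: "lipschitz_gradients D \<Omega> dJ H"
    and "\<mu> > 0" and str_mono: "strongly_monotone \<Omega> dJ \<mu>"
    and a1: "0 < a1" "a1 < 1 / 2"
    and a2: "2 / 3 < a2" "a2 < 1"
    and vgne: "\<forall>t\<ge>1. variational_GNE \<Omega> dJ g t (xs t)"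
    and "\<Lambda> > 0"
    and multipliers: "\<forall>T\<ge>1. \<forall>t\<in>{1..T}. \<exists>lam.
           weighted_multiplier \<Omega> dJ dg t (xs t) (gamma_step a2 T t) lam \<and> norm lam \<le> \<Lambda>"
  shows "(\<forall>i. \<exists>C1>0. \<exists>C2>0. \<forall>T\<ge>1. \<forall>X Xt lam.
            algorithm_run \<Omega> dJ g dg A \<phi> d\<phi>
              (alpha_step a1) (beta_step a2 T) (gamma_step a2 T) X Xt lam \<longrightarrow>
            \<bar>regret J xs (actions X) i T\<bar>
              \<le> C1 * real T powr (Max {1 / 2 + a1, 1 / 2 + a2 / 2, 1 - a1 / 2})
                + C2 * (real T powr (1 / 2 + a1) * sqrt (path_length xs T)))
       \<and> (\<exists>C1>0. \<exists>C2>0. \<forall>T\<ge>1. \<forall>X Xt lam.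
            algorithm_run \<Omega> dJ g dg A \<phi> d\<phi>
              (alpha_step a1) (beta_step a2 T) (gamma_step a2 T) X Xt lam \<longrightarrow>
            \<bar>constraint_violation g (actions X) T\<bar>
              \<le> C1 * real T powr (max (1 - a1 / 2) (2 - 3 / 2 * a2))
                + C2 * (real T powr (max (1 / 2 + a1 / 2) (3 / 2 + a1 - 3 * a2 / 2))
                        * sqrt (path_length xs T)))"
proof -
  obtain \<sigma> where \<sigma>: "0 \<le> \<sigma>" "\<sigma> < 1"
    "\<And>v h. v $ h = 0 \<or> (\<Sum>i\<in>UNIV. v $ i) = 0 \<Longrightarrow> norm (A *v v) \<le> \<sigma> * norm v"
    using averaging_contraction[OF graph] by blast
  define \<mu>0 where "\<mu>0 = Min (range \<mu>\<phi>)"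
  have "\<mu>0 \<in> range \<mu>\<phi>" unfolding \<mu>0_def by (intro Min_in) auto
  then have "0 < \<mu>0" using generators by (auto simp: bregman_generators_def)
  moreover have "\<mu>0 \<le> \<mu>\<phi> i" for i unfolding \<mu>0_def by (intro Min_le) auto
  ultimately interpret game: tracking_game D \<Omega> J dJ g dg E A \<phi> d\<phi> \<mu>\<phi> xs L M K H \<mu> \<Lambda> a1 a2 \<sigma> \<mu>0 "real CARD('p)"
    using assms \<sigma> by unfold_locales auto
  let ?run = "\<lambda>T. algorithm_run \<Omega> dJ g dg A \<phi> d\<phi> (alpha_step a1) (beta_step a2 T) (gamma_step a2 T)"
  have online: "online_run D \<Omega> J dJ g dg E A \<phi> d\<phi> \<mu>\<phi> xs L M K H \<mu> \<Lambda> a1 a2 \<sigma> \<mu>0 (real CARD('p)) T X Xt lam"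
    if "T \<ge> 1" "?run T X Xt lam" for T X Xt lam
    using that by unfold_locales auto
  \<comment> \<open>All constants below belong to the game alone and are fixed before the horizon and the run.\<close>
  define q where "q = Max {1 / 2 + a1, 1 / 2 + a2 / 2, 1 - a1 / 2}"
  have q: "1 / 2 + a1 \<le> q" "1 / 2 + a2 / 2 \<le> q" "1 - a1 / 2 \<le> q"
    unfolding q_def by (intro Max_ge; simp)+
  define c where "c = M * sqrt (game.primal_const / \<mu>)"
  define c' where "c' = sqrt (56 * game.primal_const * game.dual_const)"
  have c: "0 < c" "0 < c'"
    using game.constants_pos \<open>M > 0\<close> \<open>\<mu> > 0\<close> by (auto simp: c_def c'_def)
  have reg: "\<bar>regret J xs (actions X) i T\<bar>
      \<le> 2 * c * real T powr q + c * (real T powr (1 / 2 + a1) * sqrt (path_length xs T))"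
    if "T \<ge> 1" "?run T X Xt lam" for i T X Xt lam
    using online_run.regret_bound[OF online[OF that] q, of i]
    by (simp add: c_def algebra_simps)
  have viol: "\<bar>constraint_violation g (actions X) T\<bar>
      \<le> 2 * c' * real T powr (max (1 - a1 / 2) (2 - 3 / 2 * a2))
        + c' * (real T powr (max (1 / 2 + a1 / 2) (3 / 2 + a1 - 3 * a2 / 2)) * sqrt (path_length xs T))"
    if "T \<ge> 1" "?run T X Xt lam" for T X Xt lam
  proof -
    have "0 \<le> constraint_violation g (actions X) T" by (simp add: constraint_violation_def)
    with online_run.violation_bound[OF online[OF that]] show ?thesis
      unfolding c'_def[symmetric] by (simp add: distrib_left mult_ac)
  qed
  show ?thesis
  proof (intro conjI allI)
    fix i
    show "\<exists>C1>0. \<exists>C2>0. \<forall>T\<ge>1. \<forall>X Xt lam. ?run T X Xt lam \<longrightarrow>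
        \<bar>regret J xs (actions X) i T\<bar>
          \<le> C1 * real T powr (Max {1 / 2 + a1, 1 / 2 + a2 / 2, 1 - a1 / 2})
            + C2 * (real T powr (1 / 2 + a1) * sqrt (path_length xs T))"
      unfolding q_def[symmetric] using reg c by (intro exI[of _ "2 * c"] exI[of _ c]) auto
  next
    show "\<exists>C1>0. \<exists>C2>0. \<forall>T\<ge>1. \<forall>X Xt lam. ?run T X Xt lam \<longrightarrow>
        \<bar>constraint_violation g (actions X) T\<bar>
          \<le> C1 * real T powr (max (1 - a1 / 2) (2 - 3 / 2 * a2))
            + C2 * (real T powr (max (1 / 2 + a1 / 2) (3 / 2 + a1 - 3 * a2 / 2))
                    * sqrt (path_length xs T))"
      using viol c by (intro exI[of _ "2 * c'"] exI[of _ c'] conjI allI impI) auto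
  qed
qed

end
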